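(* Let $\mathbf X=(X,\mathcal E)$ be a coarsely locally finite coarse space, and let $\mathcal H_{\mathbf X}$ be a discrete $\mathbf X$-module. Then $C^*_{\mathrm{cp}}(\mathcal H_{\mathbf X})\cap C^*_{\mathrm{lc}}(\mathcal H_{\mathbf X})$ has an approximate unit $(p_\lambda)_{\lambda\in\Lambda}$ consisting of projections such that (i) $(p_\lambda)_{\lambda\in\Lambda}$ is equi controlled, with propagation controlled by a discreteness gauge of $\mathcal H_{\mathbf X}$ (i.e. there is a discreteness gauge $\widetilde E$ with $\mathrm{Supp}(p_\lambda)\subseteq\widetilde E$ for all $\lambda$); (ii) $p_\lambda$ has locally finite rank for all $\lambda\in\Lambda$. In particular, $p_\lambda\in\mathbb C_{\mathrm{Roe}}[\mathcal H_{\mathbf X}]$ for all $\lambda$, and hence $C^*_{\mathrm{cp}}(\mathcal H_{\mathbf X})\cap C^*_{\mathrm{lc}}(\mathcal H_{\mathbf X})=C^*_{\mathrm{Roe}}(\mathcal H_{\mathbf X})$.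
   Context: For relations $E,F\subseteq X\times X$: $E^T=\{(x,y):(y,x)\in E\}$, $E\circ F=\{(z,x):\exists y,(z,y)\in E,(y,x)\in F\}$, $E(A)=\{y:\exists a\in A,(y,a)\in E\}$; $B,A\subseteq X$ are $E$-separated if $B\cap E(A)=\emptyset$. A coarse structure on $X$ is a non-empty family $\mathcal E$ of subsets of $X\times X$, closed under subsets and finite unions, containing the diagonal $\Delta_X$, and closed under $E\mapsto E^T$ and composition. A gauge is a symmetric element of $\mathcal E$ containing $\Delta_X$. $A\subseteq X$ is $E$-bounded if $A\times A\subseteq E$, bounded if $A\times A\in\mathcal E$. A controlled partition is a partition of $X$ whose members are all $E$-bounded for a common $E\in\mathcal E$. A family of subsets is locally finite if every bounded set meets only finitely many members. $\mathbf X$ is coarsely locally finite if it admits a locally finite controlled partition. An $\mathbf X$-module consists of a Boolean algebra $\mathfrak A$ of subsets of $X$ with $X\in\mathfrak A$ (its members are called measurable), a Hilbert space $\mathcal H$, and a map $\mathbb 1_\bullet$ from $\mathfrak A$ to projections in $\mathcal B(\mathcal H)$ with $\mathbb 1_\emptyset=0$, $\mathbb 1_X=1$, $\mathbb 1_{A\cap B}=\mathbb 1_A\mathbb 1_B$, $\mathbb 1_{A\cup B}=\mathbb 1_A+\mathbb 1_B-\mathbb 1_A\mathbb 1_B$, non-degenerate in the sense that for some gauge $\widetilde E$ the subspaces $\mathbb 1_A(\mathcal H)$ with $A$ measurable and $\widetilde E$-bounded span a dense subspace. It is discrete if there are a gauge $\widetilde E$ (a discreteness gauge) and a partition $X=\bigsqcup_{i\in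 I}A_i$ (a discrete partition) into measurable $\widetilde E$-bounded sets with $\sum_i\mathbb 1_{A_i}=1$ strongly, and such that every $C\subseteq X$ with $C\cap A_i\in\mathfrak A$ for all $i$ is in $\mathfrak A$. For $t\in\mathcal B(\mathcal H)$, $\mathrm{Supp}(t)\subseteq E$ means $\mathbb 1_Bt\mathbb 1_A=0$ for all $E$-separated measurable $B,A$; $t$ has controlled propagation if $\mathrm{Supp}(t)\subseteq E$ for some $E\in\mathcal E$; a family $(t_\ell)$ is equi controlled if one $E\in\mathcal E$ works for all its members. $t$ is locally compact (resp. has locally finite rank) if $\mathbb 1_At$ and $t\mathbb 1_A$ are compact (resp. of finite rank) for every bounded measurable $A$. $C^*_{\mathrm{cp}}(\mathcal H)$ is the norm closure of the operators of controlled propagation; $C^*_{\mathrm{lc}}(\mathcal H)$ is the set of locally compact operators; $\mathbb C_{\mathrm{Roe}}[\mathcal H]$ is the $*$-algebra of locally compact operators of controlled propagation and $C^*_{\mathrm{Roe}}(\mathcal H)$ is its norm closure. *)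

theory Defs
  imports "HOL-Analysis.Analysis"
begin

section \<open>Complex Hilbert spaces and their operators\<close>

text \<open>
  A complex Hilbert space is a complete real inner product space, whose norm and topology are the
  library's, together with a complex scalar multiplication extending the real one and a
  sesquilinear inner product (linear in the first argument) with real part \<open>inner\<close>. Positive
  definiteness and \<open>norm x = sqrt (cinner x x)\<close> are inherited from \<open>real_inner\<close>.
\<close>

class chilbert_space = real_inner + complete_space +
  fixes scaleC :: "complex \<Rightarrow> 'a \<Rightarrow> 'a"  (infixr \<open>*c\<close> 75)
    and cinner :: "'a \<Rightarrow> 'a \<Rightarrow> complex"
  assumes scaleC_add_right: "a *c (x + y) = a *c x + a *c y"
    and scaleC_add_left: "(a + b) *c x = a *c x + b *c x"
    and scaleC_scaleC: "a *c (b *c x) = (a * b) *c x"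
    and scaleR_scaleC: "scaleR r x = complex_of_real r *c x"
    and cinner_commute: "cinner x y = cnj (cinner y x)"
    and cinner_add_left: "cinner (x + y) z = cinner x z + cinner y z"
    and cinner_scaleC_left: "cinner (a *c x) y = a * cinner x y"
    and Re_cinner: "Re (cinner x y) = inner x y"
begin

subclass banach ..

end

instantiation complex :: chilbert_space
begin

definition scaleC_complex :: "complex \<Rightarrow> complex \<Rightarrow> complex" where
  "scaleC_complex a x = a * x"

definition cinner_complex :: "complex \<Rightarrow> complex \<Rightarrow> complex" where
  "cinner_complex x y = x * cnj y"

instance
  by standard
    (auto simp: scaleC_complex_def cinner_complex_def algebra_simps scaleR_conv_of_real
      inner_complex_def)

end

global_interpretation complex_vector:
  vector_space "scaleC :: complex \<Rightarrow> 'h \<Rightarrow> 'h :: chilbert_space"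
proof
  fix x :: 'h
  show "1 *c x = x"
    using scaleR_scaleC[of 1 x] by simp
qed (simp_all add: scaleC_add_right scaleC_add_left scaleC_scaleC)

text \<open>
  The library type \<open>'h \<Rightarrow>\<^sub>L 'h\<close> consists of the bounded real-linear operators with the operator
  norm; the bounded complex-linear ones form a norm-closed subspace of it, so norm closures of
  subsets of \<open>cblinfuns\<close> may be taken in either space.
\<close>

definition cblinfuns :: "('h::chilbert_space \<Rightarrow>\<^sub>L 'h) set" where
  "cblinfuns = {t. \<forall>c x. blinfun_apply t (c *c x) = c *c blinfun_apply t x}"

definition is_projection :: "('h::chilbert_space \<Rightarrow>\<^sub>L 'h) \<Rightarrow> bool" where
  "is_projection p \<longleftrightarrow> p \<in> cblinfuns \<and> p o\<^sub>L p = p \<and>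
     (\<forall>x y. cinner (blinfun_apply p x) y = cinner x (blinfun_apply p y))"

definition positive_op :: "('h::chilbert_space \<Rightarrow>\<^sub>L 'h) \<Rightarrow> bool" where
  "positive_op t \<longleftrightarrow> t \<in> cblinfuns \<and>
     (\<forall>x. Im (cinner (blinfun_apply t x) x) = 0 \<and> 0 \<le> Re (cinner (blinfun_apply t x) x))"

definition compact_op :: "('h::chilbert_space \<Rightarrow>\<^sub>L 'h) \<Rightarrow> bool" where
  "compact_op t \<longleftrightarrow> compact (closure (blinfun_apply t ` cball 0 1))"

definition finite_rank :: "('h::chilbert_space \<Rightarrow>\<^sub>L 'h) \<Rightarrow> bool" where
  "finite_rank t \<longleftrightarrow> (\<exists>S. finite S \<and> range (blinfun_apply t) \<subseteq> complex_vector.span S)"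


section \<open>Approximate units\<close>

definition directed_by :: "'i set \<Rightarrow> ('i \<Rightarrow> 'i \<Rightarrow> bool) \<Rightarrow> bool" where
  "directed_by \<Lambda> le \<longleftrightarrow> \<Lambda> \<noteq> {} \<and> reflp_on \<Lambda> le \<and> transp_on \<Lambda> le \<and>
     (\<forall>k\<in>\<Lambda>. \<forall>l\<in>\<Lambda>. \<exists>m\<in>\<Lambda>. le k m \<and> le l m)"

definition net_tendsto ::
    "'i set \<Rightarrow> ('i \<Rightarrow> 'i \<Rightarrow> bool) \<Rightarrow> ('i \<Rightarrow> 'a::metric_space) \<Rightarrow> 'a \<Rightarrow> bool" where
  "net_tendsto \<Lambda> le f a \<longleftrightarrow> (\<forall>e>0. \<exists>k\<in>\<Lambda>. \<forall>l\<in>\<Lambda>. le k l \<longrightarrow> dist (f l) a < e)"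

text \<open>An approximate unit is an increasing net of positive contractions in the algebra.
  Nets of projections of this kind can be indexed by operators without loss of generality: for
  projections \<open>p \<le> q\<close> one has \<open>norm (a - q a) \<le> norm (a - p a)\<close>, so the net may be replaced by the
  set of its values, directed by the operator order.\<close>

definition approximate_unit ::
    "('h::chilbert_space \<Rightarrow>\<^sub>L 'h) set \<Rightarrow> 'i set \<Rightarrow> ('i \<Rightarrow> 'i \<Rightarrow> bool) \<Rightarrow> ('i \<Rightarrow> 'h \<Rightarrow>\<^sub>L 'h) \<Rightarrow> bool" where
  "approximate_unit A \<Lambda> le u \<longleftrightarrow> directed_by \<Lambda> le \<and>
     (\<forall>l\<in>\<Lambda>. u l \<in> A \<and> positive_op (u l) \<and> norm (u l) \<le> 1) \<and>
     (\<forall>k\<in>\<Lambda>. \<forall>l\<in>\<Lambda>. le k l \<longrightarrow> positive_op (u l - u k)) \<and>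
     (\<forall>a\<in>A. net_tendsto \<Lambda> le (\<lambda>l. u l o\<^sub>L a) a \<and> net_tendsto \<Lambda> le (\<lambda>l. a o\<^sub>L u l) a)"


section \<open>Coarse spaces\<close>

text \<open>
  In terms of the library's relations, \<open>E\<^sup>T\<close> is \<open>E\<inverse>\<close>, \<open>E \<circ> F\<close> is \<open>E O F\<close>, and
  \<open>E(A) = {y. \<exists>a\<in>A. (y, a) \<in> E}\<close> is \<open>E\<inverse> `` A\<close>.
\<close>

locale coarse_space =
  fixes X :: "'x set" and \<E> :: "('x \<times> 'x) set set"
  assumes nonempty: "\<E> \<noteq> {}"
    and subset_square: "E \<in> \<E> \<Longrightarrow> E \<subseteq> X \<times> X"
    and subset_closed: "E \<in> \<E> \<Longrightarrow> F \<subseteq> E \<Longrightarrow> F \<in> \<E>"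
    and Un_closed: "E \<in> \<E> \<Longrightarrow> F \<in> \<E> \<Longrightarrow> E \<union> F \<in> \<E>"
    and diagonal: "Id_on X \<in> \<E>"
    and converse_closed: "E \<in> \<E> \<Longrightarrow> E\<inverse> \<in> \<E>"
    and relcomp_closed: "E \<in> \<E> \<Longrightarrow> F \<in> \<E> \<Longrightarrow> E O F \<in> \<E>"

definition separated :: "('x \<times> 'x) set \<Rightarrow> 'x set \<Rightarrow> 'x set \<Rightarrow> bool" where
  "separated E B A \<longleftrightarrow> B \<inter> E\<inverse> `` A = {}"

definition gauge_of :: "'x set \<Rightarrow> ('x \<times> 'x) set set \<Rightarrow> ('x \<times> 'x) set \<Rightarrow> bool" where
  "gauge_of X \<E> E \<longleftrightarrow> E \<in> \<E> \<and> sym E \<and> Id_on X \<subseteq> E"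

definition rel_bounded :: "'x set \<Rightarrow> ('x \<times> 'x) set \<Rightarrow> 'x set \<Rightarrow> bool" where
  "rel_bounded X E A \<longleftrightarrow> A \<subseteq> X \<and> A \<times> A \<subseteq> E"

definition coarsely_bounded :: "'x set \<Rightarrow> ('x \<times> 'x) set set \<Rightarrow> 'x set \<Rightarrow> bool" where
  "coarsely_bounded X \<E> A \<longleftrightarrow> A \<subseteq> X \<and> A \<times> A \<in> \<E>"

definition controlled_partition :: "'x set \<Rightarrow> ('x \<times> 'x) set set \<Rightarrow> 'x set set \<Rightarrow> bool" where
  "controlled_partition X \<E> P \<longleftrightarrow> partition_on X P \<and> (\<exists>E\<in>\<E>. \<forall>A\<in>P. rel_bounded X E A)"

definition locally_finite_family :: "'x set \<Rightarrow> ('x \<times> 'x) set set \<Rightarrow> 'x set set \<Rightarrow> bool" where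
  "locally_finite_family X \<E> P \<longleftrightarrow>
     (\<forall>B. coarsely_bounded X \<E> B \<longrightarrow> finite {A \<in> P. A \<inter> B \<noteq> {}})"

definition coarsely_locally_finite :: "'x set \<Rightarrow> ('x \<times> 'x) set set \<Rightarrow> bool" where
  "coarsely_locally_finite X \<E> \<longleftrightarrow>
     (\<exists>P. controlled_partition X \<E> P \<and> locally_finite_family X \<E> P)"


section \<open>Modules over coarse spaces\<close>

locale coarse_module = coarse_space X \<E> + algebra X \<A>
  for X :: "'x set" and \<E> :: "('x \<times> 'x) set set" and \<A> :: "'x set set" +
  fixes ind :: "'x set \<Rightarrow> 'h::chilbert_space \<Rightarrow>\<^sub>L 'h"
  assumes ind_projection: "A \<in> \<A> \<Longrightarrow> is_projection (ind A)"
    and ind_empty: "ind {} = 0"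
    and ind_whole: "ind X = id_blinfun"
    and ind_Int: "A \<in> \<A> \<Longrightarrow> B \<in> \<A> \<Longrightarrow> ind (A \<inter> B) = ind A o\<^sub>L ind B"
    and ind_Un: "A \<in> \<A> \<Longrightarrow> B \<in> \<A> \<Longrightarrow> ind (A \<union> B) = ind A + ind B - (ind A o\<^sub>L ind B)"
    and nondegenerate: "\<exists>E. gauge_of X \<E> E \<and>
      closure (complex_vector.span
        (\<Union>A\<in>{A \<in> \<A>. rel_bounded X E A}. range (blinfun_apply (ind A)))) = UNIV"

text \<open>
  The index set of a discrete partition is the set of its members. Parts are nonempty, which is no
  restriction because \<open>ind {} = 0\<close>.
\<close>

definition discrete_partition ::
    "'x set \<Rightarrow> 'x set set \<Rightarrow> ('x set \<Rightarrow> 'h::chilbert_space \<Rightarrow>\<^sub>L 'h) \<Rightarrow>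
      ('x \<times> 'x) set \<Rightarrow> 'x set set \<Rightarrow> bool" where
  "discrete_partition X \<A> ind E P \<longleftrightarrow> partition_on X P \<and>
     (\<forall>A\<in>P. A \<in> \<A> \<and> rel_bounded X E A) \<and>
     (\<forall>v. ((\<lambda>A. blinfun_apply (ind A) v) has_sum v) P) \<and>
     (\<forall>C\<subseteq>X. (\<forall>A\<in>P. C \<inter> A \<in> \<A>) \<longrightarrow> C \<in> \<A>)"

definition discreteness_gauge ::
    "'x set \<Rightarrow> ('x \<times> 'x) set set \<Rightarrow> 'x set set \<Rightarrow> ('x set \<Rightarrow> 'h::chilbert_space \<Rightarrow>\<^sub>L 'h) \<Rightarrow>
      ('x \<times> 'x) set \<Rightarrow> bool" where
  "discreteness_gauge X \<E> \<A> ind E \<longleftrightarrow>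
     gauge_of X \<E> E \<and> (\<exists>P. discrete_partition X \<A> ind E P)"

definition discrete_module ::
    "'x set \<Rightarrow> ('x \<times> 'x) set set \<Rightarrow> 'x set set \<Rightarrow> ('x set \<Rightarrow> 'h::chilbert_space \<Rightarrow>\<^sub>L 'h) \<Rightarrow> bool" where
  "discrete_module X \<E> \<A> ind \<longleftrightarrow>
     coarse_module X \<E> \<A> ind \<and> (\<exists>E. discreteness_gauge X \<E> \<A> ind E)"


section \<open>Roe-like algebras\<close>

definition supp_within ::
    "'x set set \<Rightarrow> ('x set \<Rightarrow> 'h::chilbert_space \<Rightarrow>\<^sub>L 'h) \<Rightarrow> ('h \<Rightarrow>\<^sub>L 'h) \<Rightarrow>
      ('x \<times> 'x) set \<Rightarrow> bool" where
  "supp_within \<A> ind t E \<longleftrightarrow>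
     (\<forall>B\<in>\<A>. \<forall>A\<in>\<A>. separated E B A \<longrightarrow> ind B o\<^sub>L t o\<^sub>L ind A = 0)"

definition controlled_propagation ::
    "('x \<times> 'x) set set \<Rightarrow> 'x set set \<Rightarrow> ('x set \<Rightarrow> 'h::chilbert_space \<Rightarrow>\<^sub>L 'h) \<Rightarrow>
      ('h \<Rightarrow>\<^sub>L 'h) \<Rightarrow> bool" where
  "controlled_propagation \<E> \<A> ind t \<longleftrightarrow> (\<exists>E\<in>\<E>. supp_within \<A> ind t E)"

definition locally_compact_op ::
    "'x set \<Rightarrow> ('x \<times> 'x) set set \<Rightarrow> 'x set set \<Rightarrow> ('x set \<Rightarrow> 'h::chilbert_space \<Rightarrow>\<^sub>L 'h) \<Rightarrow>
      ('h \<Rightarrow>\<^sub>L 'h) \<Rightarrow> bool" where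
  "locally_compact_op X \<E> \<A> ind t \<longleftrightarrow>
     (\<forall>A\<in>\<A>. coarsely_bounded X \<E> A \<longrightarrow> compact_op (ind A o\<^sub>L t) \<and> compact_op (t o\<^sub>L ind A))"

definition locally_finite_rank ::
    "'x set \<Rightarrow> ('x \<times> 'x) set set \<Rightarrow> 'x set set \<Rightarrow> ('x set \<Rightarrow> 'h::chilbert_space \<Rightarrow>\<^sub>L 'h) \<Rightarrow>
      ('h \<Rightarrow>\<^sub>L 'h) \<Rightarrow> bool" where
  "locally_finite_rank X \<E> \<A> ind t \<longleftrightarrow>
     (\<forall>A\<in>\<A>. coarsely_bounded X \<E> A \<longrightarrow> finite_rank (ind A o\<^sub>L t) \<and> finite_rank (t o\<^sub>L ind A))"

definition Cstar_cp ::
    "('x \<times> 'x) set set \<Rightarrow> 'x set set \<Rightarrow> ('x set \<Rightarrow> 'h::chilbert_space \<Rightarrow>\<^sub>L 'h) \<Rightarrow>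
      ('h \<Rightarrow>\<^sub>L 'h) set" where
  "Cstar_cp \<E> \<A> ind = closure {t \<in> cblinfuns. controlled_propagation \<E> \<A> ind t}"

definition Cstar_lc ::
    "'x set \<Rightarrow> ('x \<times> 'x) set set \<Rightarrow> 'x set set \<Rightarrow> ('x set \<Rightarrow> 'h::chilbert_space \<Rightarrow>\<^sub>L 'h) \<Rightarrow>
      ('h \<Rightarrow>\<^sub>L 'h) set" where
  "Cstar_lc X \<E> \<A> ind = {t \<in> cblinfuns. locally_compact_op X \<E> \<A> ind t}"

definition Roe_alg ::
    "'x set \<Rightarrow> ('x \<times> 'x) set set \<Rightarrow> 'x set set \<Rightarrow> ('x set \<Rightarrow> 'h::chilbert_space \<Rightarrow>\<^sub>L 'h) \<Rightarrow>
      ('h \<Rightarrow>\<^sub>L 'h) set" where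
  "Roe_alg X \<E> \<A> ind =
     {t \<in> cblinfuns. locally_compact_op X \<E> \<A> ind t \<and> controlled_propagation \<E> \<A> ind t}"

definition Cstar_Roe ::
    "'x set \<Rightarrow> ('x \<times> 'x) set set \<Rightarrow> 'x set set \<Rightarrow> ('x set \<Rightarrow> 'h::chilbert_space \<Rightarrow>\<^sub>L 'h) \<Rightarrow>
      ('h \<Rightarrow>\<^sub>L 'h) set" where
  "Cstar_Roe X \<E> \<A> ind = closure (Roe_alg X \<E> \<A> ind)"

end

theory Submission
  imports Defs
begin

text \<open>
  Grouping the parts of a discrete partition along a locally finite controlled partition yields a
  discrete partition \<open>P\<close> that is itself locally finite. The approximate unit consists of the
  projections commuting with all \<open>ind A\<close>, \<open>A \<in> P\<close>, and of finite rank on each of their ranges;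
  they are assembled freely from finite-rank projections below the \<open>ind A\<close>.

  Let \<open>t\<close> be locally compact and the limit of operators of controlled propagation. Each \<open>ind A t\<close>
  and \<open>t ind A\<close> is compact, so it is approximated within \<open>\<delta> A\<close> by a finite-rank projection
  below \<open>ind A\<close>; there may be uncountably many parts, so these errors cannot simply be summed.
  However, local finiteness confines each of the controlled sets supporting the approximating
  sequence to finitely many neighbours of a part. The parts therefore fall into countable components
  with respect to which \<open>t\<close> is block diagonal. Within a component the errors \<open>\<delta> A\<close> are chosen
  summable, and the norm of a block diagonal operator is the supremum of the norms of its blocks.
\<close>

section \<open>Complex Hilbert spaces\<close>

text \<open>Accuracy is never demanded of one particular projection. It is encoded by finite sets of
  vectors, one set in the range of each \<open>ind A\<close>, that a projection has to fix. Every
  larger projection fixes them too, two demands combine by union, and a given member of the net lies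
  below every member that fixes suitable finite spanning sets of its range, part by part.
  Directedness and convergence thus both rest on one existence statement,
  \<open>lf_projection_fixing\<close>.

  The components and the errors \<delta> depend on \<open>t\<close>, whereas the projections depend
  only on the partition; hence one net serves all operators.

  For the equality with the Roe algebra, neither \<open>t\<close> times a projection
  \<open>p\<close> of the net nor an approximant \<open>s\<close> of \<open>t\<close> is in general
  both controlled and locally compact, but \<open>s\<close> times \<open>p\<close> is: the
  controlled set of \<open>s\<close> enlarges a bounded set to a bounded set, which meets finitely
  many parts, and on these \<open>p\<close> has finite rank.\<close>

lemma cinner_add_right: "cinner x (y + z :: 'h::chilbert_space) = cinner x y + cinner x z"
  by (metis cinner_add_left cinner_commute complex_cnj_add)

lemma cinner_scaleC_right: "cinner x (a *c y :: 'h::chilbert_space) = cnj a * cinner x y"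
  by (metis cinner_commute cinner_scaleC_left complex_cnj_mult)

lemma cinner_scaleR_left: "cinner (r *\<^sub>R x) (y :: 'h::chilbert_space) = r *\<^sub>R cinner x y"
  by (metis cinner_scaleC_left scaleR_scaleC scaleR_conv_of_real)

lemma cinner_minus_left: "cinner (- x) (y :: 'h::chilbert_space) = - cinner x y"
  using cinner_scaleR_left[of "-1" x y] by simp

lemma cinner_diff_left: "cinner (x - y) (z :: 'h::chilbert_space) = cinner x z - cinner y z"
  using cinner_add_left[of x "- y" z] by (simp add: cinner_minus_left)

lemma cinner_diff_right: "cinner x (y - z :: 'h::chilbert_space) = cinner x y - cinner x z"
  by (metis cinner_diff_left cinner_commute complex_cnj_diff)

lemma cinner_zero_left [simp]: "cinner 0 (y :: 'h::chilbert_space) = 0"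
  using cinner_diff_left[of 0 0 y] by simp

lemma cinner_zero_right [simp]: "cinner x (0 :: 'h::chilbert_space) = 0"
  using cinner_diff_right[of x 0 0] by simp

lemma cinner_self: "cinner x (x :: 'h::chilbert_space) = of_real ((norm x)\<^sup>2)"
proof (rule complex_eqI)
  show "Re (cinner x x) = Re (of_real ((norm x)\<^sup>2))"
    by (simp add: Re_cinner power2_norm_eq_inner)
  show "Im (cinner x x) = Im (of_real ((norm x)\<^sup>2))"
    using cinner_commute[of x x] by (simp add: complex_eq_iff)
qed

lemma cinner_eqI:
  fixes x y :: "'h::chilbert_space"
  assumes "\<And>z. cinner z x = cinner z y"
  shows "x = y"
  using assms[of "x - y"] cinner_self[of "x - y"] by (simp add: cinner_diff_right)

lemma norm_scaleC: "norm (a *c (x :: 'h::chilbert_space)) = cmod a * norm x"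
proof -
  have "complex_of_real ((norm (a *c x))\<^sup>2) = (a * cnj a) * cinner x x"
    by (simp only: cinner_self[symmetric]) (simp add: cinner_scaleC_left cinner_scaleC_right)
  also have "\<dots> = of_real ((cmod a * norm x)\<^sup>2)"
    by (simp only: cinner_self complex_norm_square[symmetric]) (simp add: power_mult_distrib)
  finally show ?thesis
    by (simp only: of_real_eq_iff) (simp add: power2_eq_iff_nonneg)
qed

text \<open>The factor 2 comes from applying the real Cauchy-Schwarz inequality to the real and the
  imaginary part separately; what is drawn from the estimate is boundedness.\<close>

lemma norm_cinner_le: "cmod (cinner x y) \<le> 2 * (norm x * norm (y :: 'h::chilbert_space))"
proof -
  have "Im (cinner x y) = inner x (\<i> *c y)"
    by (simp add: Re_cinner[symmetric] cinner_scaleC_right)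
  then have "\<bar>Im (cinner x y)\<bar> \<le> norm x * norm y"
    using Cauchy_Schwarz_ineq2[of x "\<i> *c y"] by (simp add: norm_scaleC)
  moreover have "\<bar>Re (cinner x y)\<bar> \<le> norm x * norm y"
    using Cauchy_Schwarz_ineq2[of x y] by (simp add: Re_cinner)
  ultimately show ?thesis
    using cmod_le[of "cinner x y"] by linarith
qed

lemma bounded_linear_cinner_left: "bounded_linear (\<lambda>x. cinner x (y :: 'h::chilbert_space))"
  by (rule bounded_linear_intro[of _ "2 * norm y"])
    (use norm_cinner_le[of _ y] in \<open>simp_all add: cinner_add_left cinner_scaleR_left mult.left_commute\<close>)

section \<open>Unconditional sums, orthogonal families and representing vectors\<close>

lemma norm_has_sum_le:
  fixes f :: "'i \<Rightarrow> 'a::real_normed_vector"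
  assumes "(f has_sum s) A" "\<And>F. finite F \<Longrightarrow> F \<subseteq> A \<Longrightarrow> norm (sum f F) \<le> B"
  shows "norm s \<le> B"
  using assms(1) unfolding has_sum_def
  by (rule Lim_norm_ubound[rotated])
    (auto simp: eventually_finite_subsets_at_top assms(2) intro!: exI[of _ "{}"])

text \<open>An injective numbering turns the summands into distinct terms of the series of
  \<open>(1/2) ^ Suc k\<close>, whose total is 1. Numberings of countable components make their
  errors summable in this way.\<close>

lemma sum_geometric_inj_le:
  fixes n :: "'i \<Rightarrow> nat"
  assumes "finite F" "inj_on n F"
  shows "(\<Sum>i\<in>F. (1/2::real) ^ Suc (n i)) \<le> 1"
proof -
  have "(\<Sum>i\<in>F. (1/2::real) ^ Suc (n i)) = (\<Sum>k\<in>n ` F. (1/2) ^ Suc k)"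
    by (simp add: sum.reindex[OF assms(2)])
  also have "\<dots> \<le> (\<Sum>k. (1/2) ^ Suc k)"
    by (rule sum_le_suminf) (use assms(1) power_half_series sums_summable in auto)
  also have "\<dots> = 1"
    using power_half_series sums_unique by fastforce
  finally show ?thesis .
qed

lemma norm_sum_orthogonal:
  fixes f :: "'i \<Rightarrow> 'h::real_inner"
  assumes "finite F"
    and "\<And>i j. i \<in> F \<Longrightarrow> j \<in> F \<Longrightarrow> i \<noteq> j \<Longrightarrow> inner (f i) (f j) = 0"
  shows "(norm (sum f F))\<^sup>2 = (\<Sum>i\<in>F. (norm (f i))\<^sup>2)"
proof -
  have "inner (f i) (sum f F) = (norm (f i))\<^sup>2" if "i \<in> F" for i
  proof -
    have "inner (f i) (sum f F) = (\<Sum>j\<in>F. if j = i then (norm (f i))\<^sup>2 else 0)"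
      unfolding inner_sum_right
      by (rule sum.cong) (use assms(2) that in \<open>auto simp: power2_norm_eq_inner\<close>)
    then show ?thesis
      using assms(1) that by simp
  qed
  then show ?thesis
    by (simp add: power2_norm_eq_inner[of "sum f F"] inner_sum_left)
qed

text \<open>By Pythagoras the squared distance of two nested partial sums is a difference of partial
  sums of the squared norms, so the Cauchy property is inherited; completeness then gives the limit,
  for index sets of any size.\<close>

lemma summable_on_orthogonal:
  fixes f :: "'i \<Rightarrow> 'h::{real_inner,complete_space}"
  assumes orth: "\<And>i j. i \<in> A \<Longrightarrow> j \<in> A \<Longrightarrow> i \<noteq> j \<Longrightarrow> inner (f i) (f j) = 0"
    and sq: "(\<lambda>i. (norm (f i))\<^sup>2) summable_on A"
  shows "f summable_on A"
proof -
  let ?g = "\<lambda>i. (norm (f i))\<^sup>2"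
  obtain L where L: "(sum ?g \<longlongrightarrow> L) (finite_subsets_at_top A)"
    using sq unfolding summable_on_def has_sum_def by blast
  have "\<exists>P. eventually P (finite_subsets_at_top A) \<and>
              (\<forall>F F'. P F \<and> P F' \<longrightarrow> dist (sum f F) (sum f F') < e)" if "e > 0" for e
  proof -
    \<comment> \<open>Partial sums of squares within \<open>d\<close> of \<open>L\<close> differ by
      less than \<open>2 * d = (e/2)\<^sup>2\<close>, so the nested partial sums of \<open>f\<close>
      differ by less than \<open>e/2\<close>.\<close>
    define d where "d = (e/2)\<^sup>2 / 2"
    have "d > 0" using that by (simp add: d_def)
    then have "eventually (\<lambda>F. dist (sum ?g F) L < d) (finite_subsets_at_top A)"
      using L by (simp add: tendsto_iff)
    then obtain F0 where F0: "finite F0" "F0 \<subseteq> A"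
      and near: "\<And>F. finite F \<Longrightarrow> F0 \<subseteq> F \<Longrightarrow> F \<subseteq> A \<Longrightarrow> dist (sum ?g F) L < d"
      unfolding eventually_finite_subsets_at_top by auto
    have close: "dist (sum f F) (sum f F0) < e/2" if F: "finite F" "F0 \<subseteq> F" "F \<subseteq> A" for F
    proof -
      have "(dist (sum f F) (sum f F0))\<^sup>2 = (norm (sum f (F - F0)))\<^sup>2"
        using F by (simp add: dist_norm sum_diff)
      also have "\<dots> = sum ?g (F - F0)"
        by (rule norm_sum_orthogonal) (use F orth in blast)+
      also have "\<dots> = sum ?g F - sum ?g F0"
        using F by (simp add: sum_diff)
      also have "\<dots> < 2 * d"
        using near[OF F] near[OF F0(1) order_refl F0(2)] unfolding dist_real_def by linarith
      finally have "(dist (sum f F) (sum f F0))\<^sup>2 < (e/2)\<^sup>2"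
        by (simp add: d_def)
      then show ?thesis
        using \<open>e > 0\<close> by (metis divide_nonneg_pos less_eq_real_def power_less_imp_less_base zero_less_numeral)
    qed
    show ?thesis
    proof (intro exI conjI allI impI)
      show "eventually (\<lambda>F. finite F \<and> F0 \<subseteq> F \<and> F \<subseteq> A) (finite_subsets_at_top A)"
        using F0 unfolding eventually_finite_subsets_at_top by blast
      show "dist (sum f F) (sum f F') < e"
        if "(finite F \<and> F0 \<subseteq> F \<and> F \<subseteq> A) \<and> (finite F' \<and> F0 \<subseteq> F' \<and> F' \<subseteq> A)" for F F'
        by (rule dist_triangle_half_l[of _ "sum f F0"]) (simp_all only: close that)
    qed
  qed
  then have "cauchy_filter (filtermap (sum f) (finite_subsets_at_top A))"
    by (simp add: cauchy_filter_metric_filtermap)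
  moreover have "complete (UNIV :: 'h set)"
    by (meson Cauchy_convergent UNIV_I complete_def convergent_def)
  ultimately obtain l where "(sum f \<longlongrightarrow> l) (finite_subsets_at_top A)"
    using complete_uniform[where S=UNIV] by (force simp add: filterlim_def)
  then show ?thesis
    using summable_on_def has_sum_def by blast
qed

text \<open>The representing vector minimises \<open>\<lambda>v. (norm v)\<^sup>2 - 2 * f v\<close>; the parallelogram law makes
  minimising sequences Cauchy.\<close>

lemma riesz_representation:
  fixes f :: "'h::{real_inner,complete_space} \<Rightarrow> real"
  assumes "bounded_linear f"
  shows "\<exists>z. \<forall>v. f v = inner v z"
proof -
  interpret f: bounded_linear f by fact
  define g where "g v = (norm v)\<^sup>2 - 2 * f v" for v
  obtain K where K: "\<And>v. norm (f v) \<le> norm v * K"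
    using f.bounded by blast
  have "- K\<^sup>2 \<le> g v" for v
  proof -
    have "f v \<le> norm v * K" using K[of v] by simp
    moreover have "0 \<le> (norm v - K)\<^sup>2" by simp
    ultimately show ?thesis
      unfolding g_def by (simp add: power2_eq_square algebra_simps)
  qed
  then have bdd: "bdd_below (range g)"
    by (intro bdd_belowI[of _ "- K\<^sup>2"]) auto
  define I where "I = Inf (range g)"
  have I_le: "I \<le> g v" for v
    unfolding I_def using bdd by (simp add: cInf_lower)
  have "\<exists>v. g v < I + 1 / Suc n" for n
    using cInf_lessD[of "range g" "I + 1 / Suc n"] unfolding I_def by auto
  then obtain x where x: "\<And>n. g (x n) < I + 1 / Suc n"
    by metis
  have par: "(norm (u - v))\<^sup>2 \<le> 2 * (g u - I) + 2 * (g v - I)" for u v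
  proof -
    have "(norm (u - v))\<^sup>2 = 2 * g u + 2 * g v - 4 * g ((1/2) *\<^sub>R (u + v))"
      unfolding g_def power2_norm_eq_inner inner_add_left inner_add_right inner_scaleR_left
        inner_scaleR_right inner_diff_left inner_diff_right inner_commute[of v u] f.add f.scaleR real_scaleR_def
      by (simp add: algebra_simps)
    then show ?thesis using I_le[of "(1/2) *\<^sub>R (u + v)"] by simp
  qed
  have "Cauchy x"
  proof (rule metric_CauchyI)
    fix e :: real assume "e > 0"
    obtain N where N: "4 / e\<^sup>2 < real N"
      using reals_Archimedean2 by blast
    have "dist (x m) (x n) < e" if "m \<ge> N" "n \<ge> N" for m n
    proof -
      have small: "g (x k) - I < e\<^sup>2 / 4" if "k \<ge> N" for k
      proof -
        have "4 / e\<^sup>2 < Suc k"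
          using N that by linarith
        then have "1 / Suc k < e\<^sup>2 / 4"
          using \<open>e > 0\<close> by (simp add: field_simps)
        then show ?thesis using x[of k] by linarith
      qed
      have "(dist (x m) (x n))\<^sup>2 < e\<^sup>2"
        using par[of "x m" "x n"] small[OF that(1)] small[OF that(2)] by (simp add: dist_norm)
      then show ?thesis
        using \<open>e > 0\<close> by (simp add: power_less_imp_less_base)
    qed
    then show "\<exists>M. \<forall>m\<ge>M. \<forall>n\<ge>M. dist (x m) (x n) < e" by blast
  qed
  then obtain z where z: "x \<longlonglongrightarrow> z"
    using Cauchy_convergent convergent_def by blast
  have "(\<lambda>n. g (x n)) \<longlonglongrightarrow> g z"
    unfolding g_def by (intro tendsto_intros f.tendsto z)
  moreover have "(\<lambda>n. I + 1 / Suc n) \<longlonglongrightarrow> I + 0"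
    by (intro tendsto_intros LIMSEQ_Suc lim_1_over_n)
  ultimately have "g z \<le> I + 0"
    by (rule LIMSEQ_le) (use x in \<open>auto intro: less_imp_le\<close>)
  then have min: "g z \<le> g v" for v
    using I_le[of v] by linarith
  have "f v = inner v z" for v
  proof -
    define b where "b = inner v z - f v"
    have quad: "0 \<le> s\<^sup>2 * (norm v)\<^sup>2 + 2 * s * b" for s
    proof -
      have "g (z + s *\<^sub>R v) = g z + (s\<^sup>2 * (norm v)\<^sup>2 + 2 * s * b)"
        unfolding g_def b_def power2_norm_eq_inner inner_add_left inner_add_right inner_scaleR_left
          inner_scaleR_right inner_commute[of z v] f.add f.scaleR real_scaleR_def power2_eq_square[of s]
        by (simp add: algebra_simps)
      then show ?thesis using min[of "z + s *\<^sub>R v"] by linarith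
    qed
    \<comment> \<open>At \<open>s = - (t * b)\<close> the quadratic is at most
      \<open>- (t * b\<^sup>2)\<close>, because \<open>t * (norm v)\<^sup>2 \<le> 1\<close>; this
      forces \<open>b = 0\<close>. The summand 1 keeps \<open>t\<close> positive for
      \<open>v = 0\<close>.\<close>
    define t where "t = 1 / ((norm v)\<^sup>2 + 1)"
    have "0 \<le> (t * (norm v)\<^sup>2) * (t * b\<^sup>2) - 2 * (t * b\<^sup>2)"
      using quad[of "- (t * b)"] by (simp add: power2_eq_square algebra_simps)
    moreover have t: "t > 0" "t * (norm v)\<^sup>2 \<le> 1"
      by (simp_all add: t_def add_nonneg_pos divide_le_eq)
    then have "(t * (norm v)\<^sup>2) * (t * b\<^sup>2) \<le> 1 * (t * b\<^sup>2)"
      by (intro mult_right_mono) simp_all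
    ultimately have "t * b\<^sup>2 \<le> 0" by linarith
    then have "b\<^sup>2 \<le> 0"
      using t(1) by (simp add: mult_le_0_iff)
    then show ?thesis by (simp add: b_def)
  qed
  then show ?thesis by blast
qed

section \<open>Projections\<close>

lemma blinfun_compose_assoc: "(r o\<^sub>L s) o\<^sub>L t = r o\<^sub>L (s o\<^sub>L t)"
  by (rule blinfun_eqI) simp

lemma cblinfuns_compose: "s \<in> cblinfuns \<Longrightarrow> t \<in> cblinfuns \<Longrightarrow> s o\<^sub>L t \<in> cblinfuns"
  by (simp add: cblinfuns_def)

lemma cblinfuns_diff: "s \<in> cblinfuns \<Longrightarrow> t \<in> cblinfuns \<Longrightarrow> s - t \<in> cblinfuns"
  by (simp add: cblinfuns_def blinfun.diff_left complex_vector.scale_right_diff_distrib)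

lemma closed_cblinfuns: "closed (cblinfuns :: ('h::chilbert_space \<Rightarrow>\<^sub>L 'h) set)"
proof -
  have scale: "bounded_linear (\<lambda>x :: 'h. c *c x)" for c
    by (rule bounded_linear_intro[of _ "cmod c"])
      (simp_all add: scaleC_add_right norm_scaleC scaleR_scaleC scaleC_scaleC mult.commute)
  have "closed {t :: 'h \<Rightarrow>\<^sub>L 'h. blinfun_apply t (c *c x) = c *c blinfun_apply t x}" for c x
    by (intro closed_Collect_eq continuous_intros bounded_linear.continuous_on[OF scale])
  then have "closed (\<Inter>c. \<Inter>x. {t :: 'h \<Rightarrow>\<^sub>L 'h. blinfun_apply t (c *c x) = c *c blinfun_apply t x})"
    by blast
  moreover have "cblinfuns = (\<Inter>c. \<Inter>x. {t :: 'h \<Rightarrow>\<^sub>L 'h. blinfun_apply t (c *c x) = c *c blinfun_apply t x})"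
    by (auto simp: cblinfuns_def)
  ultimately show ?thesis by simp
qed

lemma is_projectionD:
  assumes "is_projection p"
  shows "p \<in> cblinfuns" "blinfun_apply p (blinfun_apply p x) = blinfun_apply p x"
    "cinner (blinfun_apply p x) y = cinner x (blinfun_apply p y)"
    "inner (blinfun_apply p x) y = inner x (blinfun_apply p y)"
proof -
  show "p \<in> cblinfuns" "cinner (blinfun_apply p x) y = cinner x (blinfun_apply p y)"
    using assms by (auto simp: is_projection_def)
  then show "inner (blinfun_apply p x) y = inner x (blinfun_apply p y)"
    by (simp add: Re_cinner[symmetric])
  show "blinfun_apply p (blinfun_apply p x) = blinfun_apply p x"
    using assms by (metis blinfun_apply_blinfun_compose is_projection_def)
qed

lemma is_projection_norm_le:
  assumes "is_projection p" shows "norm (blinfun_apply p x) \<le> norm x"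
proof -
  have "(norm (blinfun_apply p x))\<^sup>2 = inner x (blinfun_apply p x)"
    by (simp add: power2_norm_eq_inner is_projectionD[OF assms])
  also have "\<dots> \<le> norm x * norm (blinfun_apply p x)"
    by (rule norm_cauchy_schwarz)
  finally show ?thesis
    by (metis mult_right_le_imp_le norm_ge_zero not_less power2_eq_square le_less_trans)
qed

lemma is_projection_norm: "is_projection p \<Longrightarrow> norm p \<le> 1"
  by (intro norm_blinfun_bound) (simp_all add: is_projection_norm_le)

text \<open>Pythagoras. Applied to \<open>x - y\<close> with \<open>y\<close> fixed by
  \<open>p\<close>, it bounds \<open>x - p x\<close> by the distance from \<open>x\<close> to
  \<open>y\<close>.\<close>

lemma is_projection_diff_apply_norm_le:
  assumes "is_projection p" shows "norm (x - blinfun_apply p x) \<le> norm x"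
proof -
  have "inner (blinfun_apply p x) (x - blinfun_apply p x) = 0"
    by (simp add: is_projectionD[OF assms] blinfun.diff_right)
  then have "(norm x)\<^sup>2 = (norm (x - blinfun_apply p x))\<^sup>2 + (norm (blinfun_apply p x))\<^sup>2"
    unfolding power2_norm_eq_inner by (simp add: inner_simps inner_commute)
  then show ?thesis
    by (metis abs_norm_cancel add_increasing2 order_refl power2_le_iff_abs_le norm_ge_zero zero_le_power2)
qed

lemma is_projection_positive:
  assumes "is_projection p" shows "positive_op p"
proof -
  have "cinner (blinfun_apply p x) x = of_real ((norm (blinfun_apply p x))\<^sup>2)" for x
    by (metis assms cinner_self is_projectionD(2,3))
  then show ?thesis
    using is_projectionD(1)[OF assms] by (simp add: positive_op_def)
qed

text \<open>Self-adjointness reverses the product. Hence the one-sided relation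
  \<open>q o\<^sub>L p = p\<close> already is the order of projections and can direct the
  net.\<close>

lemma is_projection_absorb_comm:
  assumes p: "is_projection p" and q: "is_projection q" and "q o\<^sub>L p = p"
  shows "p o\<^sub>L q = p"
proof (rule blinfun_eqI, rule cinner_eqI)
  fix v z
  have "cinner z (blinfun_apply p (blinfun_apply q v)) = cinner (blinfun_apply (q o\<^sub>L p) z) v"
    by (simp add: is_projectionD(3)[OF p] is_projectionD(3)[OF q])
  also have "\<dots> = cinner z (blinfun_apply p v)"
    by (simp add: assms(3) is_projectionD(3)[OF p])
  finally show "cinner z (blinfun_apply (p o\<^sub>L q) v) = cinner z (blinfun_apply p v)"
    by simp
qed

text \<open>Both mixed products equal \<open>p\<close>, so the square of \<open>q - p\<close>
  collapses. This is what makes the net increasing in the operator order.\<close>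

lemma is_projection_diff:
  assumes p: "is_projection p" and q: "is_projection q" and "q o\<^sub>L p = p"
  shows "is_projection (q - p)"
proof -
  have "blinfun_apply q (blinfun_apply p x) = blinfun_apply p x" 
    "blinfun_apply p (blinfun_apply q x) = blinfun_apply p x" for x
    using is_projection_absorb_comm[OF assms] assms(3) by (metis blinfun_apply_blinfun_compose)+
  then have "(q - p) o\<^sub>L (q - p) = q - p"
    by (intro blinfun_eqI) (simp add: blinfun.bilinear_simps is_projectionD(2)[OF p] is_projectionD(2)[OF q])
  moreover have "q - p \<in> cblinfuns"
    using p q by (simp add: cblinfuns_diff is_projectionD(1))
  ultimately show ?thesis
    by (auto simp: is_projection_def blinfun.bilinear_simps cinner_diff_left cinner_diff_right
        is_projectionD(3)[OF p] is_projectionD(3)[OF q])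
qed

section \<open>Compact and finite rank operators\<close>

lemma compact_opI:
  assumes "compact K" "\<And>x. norm x \<le> 1 \<Longrightarrow> blinfun_apply t x \<in> K"
  shows "compact_op t"
proof -
  have "closure (blinfun_apply t ` cball 0 1) \<subseteq> K"
    by (rule closure_minimal) (use assms compact_imp_closed in auto)
  then show ?thesis
    unfolding compact_op_def using assms(1) by (metis closed_closure compact_Int_closed inf.absorb2)
qed

lemma compact_opD:
  assumes "compact_op t"
  obtains K where "compact K" "\<And>x. norm x \<le> 1 \<Longrightarrow> blinfun_apply t x \<in> K"
proof (rule that)
  show "compact (closure (blinfun_apply t ` cball 0 1))"
    using assms by (simp add: compact_op_def)
  show "blinfun_apply t x \<in> closure (blinfun_apply t ` cball 0 1)" if "norm x \<le> 1" for x
    using closure_subset that by fastforce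
qed

lemma compact_op_zero: "compact_op 0"
  by (rule compact_opI[of "{0}"]) auto

lemma compact_op_add:
  assumes "compact_op s" "compact_op t" shows "compact_op (s + t)"
proof -
  obtain K L where "compact K" "\<And>x. norm x \<le> 1 \<Longrightarrow> blinfun_apply s x \<in> K"
    and "compact L" "\<And>x. norm x \<le> 1 \<Longrightarrow> blinfun_apply t x \<in> L"
    using assms compact_opD by metis
  then show ?thesis
    by (intro compact_opI[OF compact_sums[of K L]]) (auto simp: blinfun.bilinear_simps)
qed

lemma compact_op_compose_left:
  assumes "compact_op t" shows "compact_op (s o\<^sub>L t)"
proof -
  obtain K where "compact K" "\<And>x. norm x \<le> 1 \<Longrightarrow> blinfun_apply t x \<in> K"
    using assms compact_opD by metis
  then show ?thesis
    by (intro compact_opI[of "blinfun_apply s ` K"])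
      (auto intro!: compact_continuous_image continuous_intros)
qed

lemma compact_op_compose_right:
  assumes "compact_op t" shows "compact_op (t o\<^sub>L s)"
proof -
  obtain K where K: "compact K" "\<And>x. norm x \<le> 1 \<Longrightarrow> blinfun_apply t x \<in> K"
    using assms compact_opD by metis
  \<comment> \<open>A radius whose ball contains the image of the unit ball under \<open>s\<close>;
    adding 1 keeps it invertible when \<open>s = 0\<close>.\<close>
  let ?r = "norm s + 1"
  have r: "?r > 0" by (simp add: add_nonneg_pos)
  have "blinfun_apply (t o\<^sub>L s) x \<in> (\<lambda>y. ?r *\<^sub>R y) ` K" if "norm x \<le> 1" for x
  proof
    have "norm (blinfun_apply s x) \<le> norm s * 1"
      using norm_blinfun[of s x] that by (meson mult_left_mono norm_ge_zero order_trans)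
    then have "norm ((1 / ?r) *\<^sub>R blinfun_apply s x) \<le> 1"
      using r by (simp add: field_simps)
    then show "blinfun_apply t ((1 / ?r) *\<^sub>R blinfun_apply s x) \<in> K"
      by (rule K)
    show "blinfun_apply (t o\<^sub>L s) x = ?r *\<^sub>R blinfun_apply t ((1 / ?r) *\<^sub>R blinfun_apply s x)"
      using r by (simp add: blinfun.scaleR_right)
  qed
  then show ?thesis
    by (intro compact_opI[of "(\<lambda>y. ?r *\<^sub>R y) ` K"] compact_scaling K)
qed

text \<open>The centres are taken inside the range of \<open>t\<close>, so that a projection
  \<open>e\<close> with \<open>e o\<^sub>L t = t\<close> fixes them.\<close>

lemma compact_op_finite_net:
  assumes "compact_op t" "e > 0"
  obtains S where "finite S" "S \<subseteq> range (blinfun_apply t)"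
    "\<And>x. norm x \<le> 1 \<Longrightarrow> \<exists>y\<in>S. norm (blinfun_apply t x - y) < e"
proof -
  let ?B = "blinfun_apply t ` cball 0 1"
  have "closure ?B \<subseteq> (\<Union>y\<in>?B. ball y e)"
    using \<open>e > 0\<close> by (force simp: closure_approachable)
  then obtain S where S: "S \<subseteq> ?B" "finite S" "closure ?B \<subseteq> (\<Union>y\<in>S. ball y e)"
    using assms(1) unfolding compact_op_def by (metis compactE_image open_ball)
  show ?thesis
  proof (rule that[OF S(2)])
    show "S \<subseteq> range (blinfun_apply t)"
      using S(1) by blast
    show "\<exists>y\<in>S. norm (blinfun_apply t x - y) < e" if "norm x \<le> 1" for x
    proof -
      have "blinfun_apply t x \<in> closure ?B"
        using closure_subset that by fastforce
      then obtain y where "y \<in> S" "blinfun_apply t x \<in> ball y e"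
        using S(3) by blast
      then show ?thesis
        by (auto simp: dist_norm norm_minus_commute)
    qed
  qed
qed

lemma compact_op_if_finite_nets:
  fixes t :: "'h::chilbert_space \<Rightarrow>\<^sub>L 'h"
  assumes "\<And>e. e > 0 \<Longrightarrow> \<exists>S. finite S \<and> (\<forall>x. norm x \<le> 1 \<longrightarrow> (\<exists>y\<in>S. norm (blinfun_apply t x - y) \<le> e))"
  shows "compact_op t"
  unfolding compact_op_def compact_eq_totally_bounded
proof (intro conjI allI impI)
  let ?B = "blinfun_apply t ` cball 0 1"
  show "complete (closure ?B)"
    by (simp add: complete_eq_closed)
  fix e :: real assume "e > 0"
  then obtain S where S: "finite S"
    "\<And>x. norm x \<le> 1 \<Longrightarrow> \<exists>y\<in>S. norm (blinfun_apply t x - y) \<le> e/2"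
    using assms[of "e/2"] by auto
  have "closure ?B \<subseteq> (\<Union>y\<in>S. cball y (e/2))"
    by (rule closure_minimal)
      (use S in \<open>auto simp: dist_norm norm_minus_commute intro!: closed_UN\<close>)
  also have "\<dots> \<subseteq> (\<Union>y\<in>S. ball y e)"
    using \<open>e > 0\<close> by fastforce
  finally show "\<exists>k. finite k \<and> closure ?B \<subseteq> (\<Union>y\<in>k. ball y e)"
    using S(1) by blast
qed

text \<open>A finite net at scale \<open>e/2\<close> for a compact operator within
  \<open>e/2\<close> of \<open>t\<close> is a net at scale \<open>e\<close> for \<open>t\<close>. It
  serves to show that \<open>Cstar_lc\<close> is closed and so contains
  \<open>Cstar_Roe\<close>.\<close>

lemma closed_compact_op: "closed {t :: 'h::chilbert_space \<Rightarrow>\<^sub>L 'h. compact_op t}"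
  unfolding closed_limpt islimpt_approachable
proof clarify
  fix t :: "'h \<Rightarrow>\<^sub>L 'h"
  assume lim: "\<forall>e>0. \<exists>s\<in>{t. compact_op t}. s \<noteq> t \<and> dist s t < e"
  show "compact_op t"
  proof (rule compact_op_if_finite_nets)
    fix e :: real assume "e > 0"
    then obtain s where s: "compact_op s" "dist s t < e/2"
      using lim by (metis half_gt_zero mem_Collect_eq)
    obtain S where S: "finite S" "\<And>x. norm x \<le> 1 \<Longrightarrow> \<exists>y\<in>S. norm (blinfun_apply s x - y) < e/2"
      using compact_op_finite_net[OF s(1), of "e/2"] \<open>e > 0\<close> by (metis half_gt_zero)
    have "\<exists>y\<in>S. norm (blinfun_apply t x - y) \<le> e" if x: "norm x \<le> 1" for x
    proof -
      obtain y where y: "y \<in> S" "norm (blinfun_apply s x - y) < e/2"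
        using S(2)[OF x] by blast
      have "norm (blinfun_apply t x - blinfun_apply s x) \<le> norm (t - s) * norm x"
        using norm_blinfun[of "t - s" x] by (simp add: blinfun.diff_left)
      also have "\<dots> \<le> norm (t - s)"
        using x by (simp add: mult_left_le)
      also have "\<dots> < e/2"
        using s(2) by (simp add: dist_norm norm_minus_commute)
      finally show ?thesis
        using y norm_triangle_ineq[of "blinfun_apply t x - blinfun_apply s x" "blinfun_apply s x - y"]
        by (intro bexI[of _ y]) auto
    qed
    then show "\<exists>S. finite S \<and> (\<forall>x. norm x \<le> 1 \<longrightarrow> (\<exists>y\<in>S. norm (blinfun_apply t x - y) \<le> e))"
      using S(1) by blast
  qed
qed

lemma rank_one_projection:
  fixes y :: "'h::chilbert_space"
  assumes "norm y = 1"
  obtains r where "\<And>x. blinfun_apply r x = cinner x y *c y" "is_projection r" "compact_op r"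
proof -
  define r where "r = Blinfun (\<lambda>x. cinner x y *c y)"
  have "bounded_linear (\<lambda>x. cinner x y *c y)"
  proof (rule bounded_linear_intro[of _ 2])
    show "norm (cinner x y *c y) \<le> norm x * 2" for x
      using norm_cinner_le[of x y] assms by (simp add: norm_scaleC)
  qed (simp_all add: cinner_add_left scaleC_add_left cinner_scaleR_left scaleR_scaleC
      scaleC_scaleC cinner_scaleC_left)
  then have r: "blinfun_apply r x = cinner x y *c y" for x
    by (simp add: r_def bounded_linear_Blinfun_apply)
  have yy: "cinner y y = 1" using assms by (simp add: cinner_self)
  have "is_projection r"
    unfolding is_projection_def
  proof (intro conjI allI)
    show "r \<in> cblinfuns"
      by (simp add: cblinfuns_def r cinner_scaleC_left scaleC_scaleC)
    show "r o\<^sub>L r = r"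
      by (rule blinfun_eqI) (simp add: r cinner_scaleC_left yy)
    show "cinner (blinfun_apply r u) v = cinner u (blinfun_apply r v)" for u v
      by (simp add: r cinner_scaleC_left cinner_scaleC_right cinner_commute[of y v] mult.commute)
  qed
  \<comment> \<open>The coefficients of unit ball vectors lie in the compact disc of radius 2, the
    constant of \<open>norm_cinner_le\<close>.\<close>
  moreover have "compact_op r"
  proof (rule compact_opI[of "(\<lambda>c. c *c y) ` cball 0 2"])
    have "bounded_linear (\<lambda>c. c *c y)"
      by (rule bounded_linear_intro[of _ "norm y"])
        (simp_all add: scaleC_add_left norm_scaleC scaleR_scaleC[where 'a='h] scaleC_scaleC scaleR_conv_of_real)
    then show "compact ((\<lambda>c. c *c y) ` cball 0 2)"
      by (intro compact_continuous_image linear_continuous_on compact_cball)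
    show "blinfun_apply r x \<in> (\<lambda>c. c *c y) ` cball 0 2" if "norm x \<le> 1" for x
      unfolding r by (rule imageI) (use norm_cinner_le[of x y] that assms in simp)
  qed
  ultimately show ?thesis using that r by blast
qed

text \<open>Gram-Schmidt, one vector at a time: a vector outside the span contributes the rank one
  projection onto its normalised component orthogonal to the span. Compactness is inherited from the
  rank one summands.\<close>

lemma span_projection:
  fixes S :: "'h::chilbert_space set"
  assumes "finite S"
  obtains p where "is_projection p" "range (blinfun_apply p) = complex_vector.span S" "compact_op p"
proof -
  have "\<exists>p. is_projection p \<and> range (blinfun_apply p) = complex_vector.span S \<and> compact_op p"
    using assms
  proof (induction S)
    case empty
    have "is_projection (0 :: 'h \<Rightarrow>\<^sub>L 'h)"
      by (auto simp: is_projection_def cblinfuns_def)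
    then show ?case
      by (intro exI[of _ 0]) (auto simp: compact_op_zero)
  next
    case (insert x S)
    then obtain p where p: "is_projection p" "range (blinfun_apply p) = complex_vector.span S" "compact_op p"
      by blast
    have fix_p: "blinfun_apply p u = u" if "u \<in> complex_vector.span S" for u
      using that p is_projectionD(2)[OF p(1)] by (metis imageE)
    define z where "z = x - blinfun_apply p x"
    have px: "blinfun_apply p x \<in> complex_vector.span S"
      using p(2) by blast
    show ?case
    proof (cases "z = 0")
      case True
      then have "complex_vector.span (insert x S) = complex_vector.span S"
        using px by (simp add: z_def complex_vector.span_redundant)
      then show ?thesis using p by auto
    next
      case False
      define y where "y = complex_of_real (1 / norm z) *c z"
      have "norm y = 1" using False by (simp add: y_def norm_scaleC norm_divide)
      then obtain r where r: "\<And>x. blinfun_apply r x = cinner x y *c y" "is_projection r" "compact_op r"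
        using rank_one_projection by metis
      have pz: "blinfun_apply p z = 0"
        by (simp add: z_def blinfun.diff_right is_projectionD(2)[OF p(1)])
      then have py: "blinfun_apply p y = 0"
        using is_projectionD(1)[OF p(1)] by (simp add: y_def cblinfuns_def)
      have pr: "blinfun_apply p (blinfun_apply r v) = 0" for v
        using is_projectionD(1)[OF p(1)] py by (simp add: r cblinfuns_def)
      have rp: "blinfun_apply r (blinfun_apply p v) = 0" for v
        by (simp add: r is_projectionD(3)[OF p(1)] py)
      have "is_projection (p + r)"
        unfolding is_projection_def
      proof (intro conjI allI)
        show "p + r \<in> cblinfuns"
          using is_projectionD(1)[OF p(1)] is_projectionD(1)[OF r(2)]
          by (simp add: cblinfuns_def blinfun.add_left scaleC_add_right)
        show "(p + r) o\<^sub>L (p + r) = p + r"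
          by (rule blinfun_eqI)
            (simp add: blinfun.add_left blinfun.add_right pr rp is_projectionD(2)[OF p(1)] is_projectionD(2)[OF r(2)])
        show "cinner (blinfun_apply (p + r) u) v = cinner u (blinfun_apply (p + r) v)" for u v
          by (simp add: blinfun.add_left cinner_add_left cinner_add_right
              is_projectionD(3)[OF p(1)] is_projectionD(3)[OF r(2)])
      qed
      moreover have "range (blinfun_apply (p + r)) = complex_vector.span (insert x S)"
      proof
        have "blinfun_apply (p + r) v \<in> complex_vector.span (insert x S)" for v
        proof -
          have pS: "blinfun_apply p u \<in> complex_vector.span (insert x S)" for u
            using p(2) complex_vector.span_mono[of S "insert x S"] by blast
          have "y \<in> complex_vector.span (insert x S)"
            unfolding y_def z_def
            by (intro complex_vector.span_scale complex_vector.span_diff pS complex_vector.span_base) simp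
          then show ?thesis
            by (simp add: blinfun.add_left r pS complex_vector.span_add complex_vector.span_scale)
        qed
        then show "range (blinfun_apply (p + r)) \<subseteq> complex_vector.span (insert x S)" by blast
        show "complex_vector.span (insert x S) \<subseteq> range (blinfun_apply (p + r))"
        proof
          fix u assume "u \<in> complex_vector.span (insert x S)"
          then obtain k where k: "u - k *c x \<in> complex_vector.span S"
            by (auto simp: complex_vector.span_insert)
          have ry: "blinfun_apply r y = y"
            using \<open>norm y = 1\<close> by (simp add: r cinner_self)
          have "z = complex_of_real (norm z) *c y"
            using False by (simp add: y_def scaleC_scaleC)
          then have rz: "blinfun_apply r z = z"
            using ry is_projectionD(1)[OF r(2)] by (metis (mono_tags, lifting) cblinfuns_def mem_Collect_eq)
          \<comment> \<open>Replacing \<open>x\<close> by its orthogonal component \<open>z\<close>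
            changes the remainder by a multiple of \<open>p x\<close>, which lies in the span of
            \<open>S\<close>; so \<open>u\<close> splits into a vector fixed by \<open>p\<close> and
            one fixed by \<open>r\<close>.\<close>
          define w where "w = u - k *c z"
          have "w = (u - k *c x) + k *c blinfun_apply p x"
            by (simp add: w_def z_def complex_vector.scale_right_diff_distrib)
          then have w: "w \<in> complex_vector.span S"
            using k px by (simp add: complex_vector.span_add complex_vector.span_scale)
          have "blinfun_apply r w = 0"
            using rp[of w] fix_p[OF w] by simp
          moreover have "u = w + k *c z" by (simp add: w_def)
          ultimately have "blinfun_apply (p + r) u = u"
            using fix_p[OF w] rz pz is_projectionD(1)[OF r(2)] is_projectionD(1)[OF p(1)]
            by (simp add: blinfun.add_left blinfun.add_right cblinfuns_def)
          then show "u \<in> range (blinfun_apply (p + r))" by (metis rangeI)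
        qed
      qed
      ultimately show ?thesis
        using compact_op_add[OF p(3) r(3)] by blast
    qed
  qed
  then show ?thesis using that by blast
qed

section \<open>Finite rank operators\<close>

lemma finite_rank_zero: "finite_rank 0"
  unfolding finite_rank_def by (rule exI[of _ "{}"]) auto

lemma finite_rank_add:
  assumes "finite_rank s" "finite_rank t" shows "finite_rank (s + t)"
proof -
  obtain S T where "finite S" "range (blinfun_apply s) \<subseteq> complex_vector.span S"
    and "finite T" "range (blinfun_apply t) \<subseteq> complex_vector.span T"
    using assms by (auto simp: finite_rank_def)
  moreover have "blinfun_apply (s + t) v \<in> complex_vector.span (S \<union> T)" for v
    unfolding blinfun.add_left
    using calculation complex_vector.span_mono[of S "S \<union> T"] complex_vector.span_mono[of T "S \<union> T"]
    by (intro complex_vector.span_add) blast+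
  ultimately show ?thesis
    unfolding finite_rank_def by (intro exI[of _ "S \<union> T"]) auto
qed

lemma cblinfuns_image_span:
  assumes "s \<in> cblinfuns" "x \<in> complex_vector.span S"
  shows "blinfun_apply s x \<in> complex_vector.span (blinfun_apply s ` S)"
  using assms(2)
proof (induction rule: complex_vector.span_induct_alt)
  case base
  then show ?case by (simp add: complex_vector.span_zero)
next
  case (step c x y)
  have "blinfun_apply s (c *c x + y) = c *c blinfun_apply s x + blinfun_apply s y"
    using assms(1) by (simp add: blinfun.add_right cblinfuns_def)
  then show ?case
    using step by (simp add: complex_vector.span_add complex_vector.span_scale complex_vector.span_base)
qed

lemma cblinfuns_fix_span:
  assumes "p \<in> cblinfuns" "\<And>x. x \<in> S \<Longrightarrow> blinfun_apply p x = x" "x \<in> complex_vector.span S"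
  shows "blinfun_apply p x = x"
  using assms(3)
proof (induction rule: complex_vector.span_induct_alt)
  case (step c x y)
  then show ?case
    using assms(1,2) by (simp add: blinfun.add_right cblinfuns_def)
qed simp

lemma finite_rank_compose_left:
  assumes "finite_rank t" "s \<in> cblinfuns" shows "finite_rank (s o\<^sub>L t)"
proof -
  obtain S where "finite S" "range (blinfun_apply t) \<subseteq> complex_vector.span S"
    using assms(1) by (auto simp: finite_rank_def)
  then show ?thesis
    unfolding finite_rank_def using cblinfuns_image_span[OF assms(2)]
    by (intro exI[of _ "blinfun_apply s ` S"]) auto
qed

lemma finite_rank_compose_right: "finite_rank t \<Longrightarrow> finite_rank (t o\<^sub>L s)"
  by (fastforce simp: finite_rank_def)

text \<open>The operator factors through the compact projection onto a finite span containing its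
  range.\<close>

lemma finite_rank_imp_compact_op:
  assumes "finite_rank t" shows "compact_op t"
proof -
  obtain S where S: "finite S" "range (blinfun_apply t) \<subseteq> complex_vector.span S"
    using assms by (auto simp: finite_rank_def)
  obtain p where p: "is_projection p" "range (blinfun_apply p) = complex_vector.span S" "compact_op p"
    using span_projection[OF S(1)] .
  have "p o\<^sub>L t = t"
  proof (rule blinfun_eqI)
    fix v
    obtain w where "blinfun_apply t v = blinfun_apply p w"
      using S(2) p(2) by blast
    then show "blinfun_apply (p o\<^sub>L t) v = blinfun_apply t v"
      by (simp add: is_projectionD(2)[OF p(1)])
  qed
  then show ?thesis
    using compact_op_compose_right[OF p(3), of t] by simp
qed

section \<open>Approximating compact operators by projections that fix finitely many vectors\<close>

lemma norm_blinfun_bound_unit: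
  assumes "0 \<le> c" "\<And>x. norm x \<le> 1 \<Longrightarrow> norm (blinfun_apply t x) \<le> c"
  shows "norm t \<le> c"
proof (rule norm_blinfun_bound[OF assms(1)])
  fix x
  show "norm (blinfun_apply t x) \<le> c * norm x"
  proof (cases "x = 0")
    case False
    then show ?thesis
      using assms(2)[of "(1 / norm x) *\<^sub>R x"] by (simp add: blinfun.scaleR_right divide_le_eq)
  qed simp
qed

text \<open>If \<open>q\<close> fixes a point \<open>y\<close> of the net near \<open>t x\<close>,
  then \<open>t x - q (t x)\<close> is the image of \<open>t x - y\<close> under the complementary
  projection. Quantifying over all \<open>q\<close> that fix \<open>S\<close> keeps the bound valid
  when \<open>q\<close> is enlarged or assembled from several parts.\<close>

lemma compact_op_approx_left:
  assumes t: "compact_op t" and e: "is_projection e" "e o\<^sub>L t = t" and "\<epsilon> > 0"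
  obtains S where "finite S" "\<And>x. x \<in> S \<Longrightarrow> blinfun_apply e x = x"
    "\<And>q. is_projection q \<Longrightarrow> (\<And>x. x \<in> S \<Longrightarrow> blinfun_apply q x = x) \<Longrightarrow> norm (t - (q o\<^sub>L t)) \<le> \<epsilon>"
proof -
  obtain S where S: "finite S" "S \<subseteq> range (blinfun_apply t)"
    "\<And>x. norm x \<le> 1 \<Longrightarrow> \<exists>y\<in>S. norm (blinfun_apply t x - y) < \<epsilon>"
    using compact_op_finite_net[OF t \<open>\<epsilon> > 0\<close>] by metis
  show ?thesis
  proof (rule that[OF S(1)])
    show "blinfun_apply e x = x" if "x \<in> S" for x
      using that S(2) e(2) by (metis blinfun_apply_blinfun_compose imageE subsetD)
    fix q :: "'a \<Rightarrow>\<^sub>L 'a" assume q: "is_projection q" and fix_q: "\<And>x. x \<in> S \<Longrightarrow> blinfun_apply q x = x"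
    show "norm (t - (q o\<^sub>L t)) \<le> \<epsilon>"
    proof (rule norm_blinfun_bound_unit)
      fix x :: 'a assume "norm x \<le> 1"
      then obtain y where y: "y \<in> S" "norm (blinfun_apply t x - y) < \<epsilon>"
        using S(3) by blast
      have "norm (blinfun_apply (t - (q o\<^sub>L t)) x)
          = norm ((blinfun_apply t x - y) - blinfun_apply q (blinfun_apply t x - y))"
        by (simp add: blinfun.bilinear_simps fix_q[OF y(1)])
      also have "\<dots> \<le> norm (blinfun_apply t x - y)"
        by (rule is_projection_diff_apply_norm_le[OF q])
      finally show "norm (blinfun_apply (t - (q o\<^sub>L t)) x) \<le> \<epsilon>"
        using y(2) by simp
    qed (use \<open>\<epsilon> > 0\<close> in simp)
  qed
qed

text \<open>If \<open>v\<close> is orthogonal to the vectors \<open>z y\<close> representing \<open>\<lambda>v. inner (t v) y\<close> for \<open>y\<close> in an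
  \<open>\<epsilon>\<close>-net of the image of the unit ball, then \<open>t v\<close> is orthogonal to a point of the net near it.\<close>

lemma compact_op_approx_right:
  assumes t: "compact_op t" and e: "is_projection e" "t o\<^sub>L e = t" and "\<epsilon> > 0"
  obtains S where "finite S" "\<And>x. x \<in> S \<Longrightarrow> blinfun_apply e x = x"
    "\<And>q. is_projection q \<Longrightarrow> (\<And>x. x \<in> S \<Longrightarrow> blinfun_apply q x = x) \<Longrightarrow> norm (t - (t o\<^sub>L q)) \<le> \<epsilon>"
proof -
  obtain S where S: "finite S"
    "\<And>x. norm x \<le> 1 \<Longrightarrow> \<exists>y\<in>S. norm (blinfun_apply t x - y) < \<epsilon>"
    using compact_op_finite_net[OF t \<open>\<epsilon> > 0\<close>] by metis
  \<comment> \<open>The representers are the values at \<open>y\<close> of the adjoint of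
    \<open>t\<close> for the real inner product.\<close>
  have "\<exists>z. \<forall>v. inner (blinfun_apply t v) y = inner v z" for y
    by (intro riesz_representation bounded_linear_inner_left_comp bounded_linear_intros)
  then obtain z where z: "\<And>v y. inner (blinfun_apply t v) y = inner v (z y)"
    by metis
  show ?thesis
  proof (rule that[of "z ` S"])
    show "finite (z ` S)" using S(1) by simp
    have "blinfun_apply e (z y) = z y" for y
    proof -
      have "inner v (blinfun_apply e (z y)) = inner v (z y)" for v
        using z[of "blinfun_apply e v" y] z[of v y] e(2)
        by (metis blinfun_apply_blinfun_compose is_projectionD(4)[OF e(1)])
      then have "inner (blinfun_apply e (z y) - z y) (blinfun_apply e (z y) - z y) = 0"
        unfolding inner_diff_right by simp
      then show ?thesis by simp
    qed
    then show "blinfun_apply e x = x" if "x \<in> z ` S" for x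
      using that by blast
    fix q :: "'a \<Rightarrow>\<^sub>L 'a" assume q: "is_projection q" and fix_q: "\<And>x. x \<in> z ` S \<Longrightarrow> blinfun_apply q x = x"
    show "norm (t - (t o\<^sub>L q)) \<le> \<epsilon>"
    proof (rule norm_blinfun_bound_unit)
      fix x :: 'a assume x: "norm x \<le> 1"
      define v where "v = x - blinfun_apply q x"
      have "norm v \<le> 1"
        using is_projection_diff_apply_norm_le[OF q, of x] x by (simp add: v_def)
      then obtain y where y: "y \<in> S" "norm (blinfun_apply t v - y) < \<epsilon>"
        using S(2) by blast
      have "inner v (z y) = 0"
        using fix_q y(1) by (simp add: v_def inner_diff_left is_projectionD(4)[OF q])
      then have "inner (blinfun_apply t v) y = 0" by (simp add: z)
      then have "(norm (blinfun_apply t v))\<^sup>2 = inner (blinfun_apply t v) (blinfun_apply t v - y)"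
        by (simp add: power2_norm_eq_inner inner_diff_right)
      also have "\<dots> \<le> norm (blinfun_apply t v) * norm (blinfun_apply t v - y)"
        by (rule norm_cauchy_schwarz)
      also have "\<dots> \<le> norm (blinfun_apply t v) * \<epsilon>"
        using y(2) by (intro mult_left_mono) auto
      finally have "norm (blinfun_apply t v) \<le> \<epsilon>"
        using \<open>\<epsilon> > 0\<close> by (cases "blinfun_apply t v = 0") (simp_all add: power2_eq_square)
      then show "norm (blinfun_apply (t - (t o\<^sub>L q)) x) \<le> \<epsilon>"
        by (simp add: v_def blinfun.bilinear_simps)
    qed (use \<open>\<epsilon> > 0\<close> in simp)
  qed
qed

section \<open>Discrete partitions\<close>

context coarse_module
begin

lemma ind_ind: "A \<in> \<A> \<Longrightarrow> B \<in> \<A> \<Longrightarrow> ind A (ind B v) = ind (A \<inter> B) v"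
  by (simp add: ind_Int)

lemma ind_ind_subset:
  assumes "A \<in> \<A>" "B \<in> \<A>" "A \<subseteq> B"
  shows "ind A (ind B v) = ind A v" "ind B (ind A v) = ind A v"
  using assms by (simp_all add: ind_ind Int_absorb2 Int_absorb1)

lemma ind_ind_disjoint: "A \<in> \<A> \<Longrightarrow> B \<in> \<A> \<Longrightarrow> A \<inter> B = {} \<Longrightarrow> ind A (ind B v) = 0"
  by (simp add: ind_ind ind_empty)

lemma ind_Diff_whole:
  assumes "A \<in> \<A>" shows "ind (X - A) v = v - ind A v"
proof -
  have "X - A \<in> \<A>" "A \<subseteq> X" using assms sets_into_space by auto
  then have "id_blinfun = ind A + ind (X - A) - (ind A o\<^sub>L ind (X - A))"
    using ind_Un[of A "X - A"] assms by (simp add: ind_whole Un_absorb1)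
  also have "ind A o\<^sub>L ind (X - A) = 0"
    using ind_Int[OF assms \<open>X - A \<in> \<A>\<close>] by (simp add: ind_empty)
  finally have "id_blinfun v = (ind A + ind (X - A)) v" by simp
  then show ?thesis by (simp add: blinfun.add_left eq_diff_eq add.commute)
qed

lemma coarsely_bounded_Image:
  assumes "coarsely_bounded X \<E> A" "E \<in> \<E>"
  shows "coarsely_bounded X \<E> (E `` A)"
proof -
  have "E\<inverse> O (A \<times> A) O E \<in> \<E>"
    using assms by (simp add: coarsely_bounded_def converse_closed relcomp_closed)
  moreover have "(E `` A) \<times> (E `` A) \<subseteq> E\<inverse> O (A \<times> A) O E" by blast
  ultimately show ?thesis
    using subset_square[OF assms(2)] subset_closed unfolding coarsely_bounded_def by blast
qed

end

text \<open>Gauge and partition are parameters because the development is used twice: for the given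
  discrete partition and for its locally finite coarsening.\<close>

locale partitioned_module = coarse_module X \<E> \<A> ind
  for X :: "'x set" and \<E> \<A> and ind :: "'x set \<Rightarrow> 'h::chilbert_space \<Rightarrow>\<^sub>L 'h" +
  fixes G P
  assumes gauge: "gauge_of X \<E> G"
    and partition: "discrete_partition X \<A> ind G P"
begin

lemma partition_on: "partition_on X P"
  using partition by (simp add: discrete_partition_def)

lemma part_measurable: "A \<in> P \<Longrightarrow> A \<in> \<A>"
  using partition by (simp add: discrete_partition_def)

lemma part_disjoint: "A \<in> P \<Longrightarrow> B \<in> P \<Longrightarrow> A \<noteq> B \<Longrightarrow> A \<inter> B = {}"
  using partition_on by (auto simp: partition_on_def disjoint_def)

lemma part_cover: "x \<in> X \<Longrightarrow> \<exists>A\<in>P. x \<in> A"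
  using partition_on by (auto simp: partition_on_def)

lemma part_subset: "A \<in> P \<Longrightarrow> A \<subseteq> X"
  using partition_on by (auto simp: partition_on_def)

lemma part_nonempty: "A \<in> P \<Longrightarrow> A \<noteq> {}"
  using partition_on by (auto simp: partition_on_def)

lemma part_gauge: "A \<in> P \<Longrightarrow> x \<in> A \<Longrightarrow> y \<in> A \<Longrightarrow> (x, y) \<in> G"
  using partition by (auto simp: discrete_partition_def rel_bounded_def)

lemma gauge_in: "G \<in> \<E>"
  using gauge by (simp add: gauge_of_def)

lemma part_bounded: "A \<in> P \<Longrightarrow> coarsely_bounded X \<E> A"
proof -
  assume A: "A \<in> P"
  then have "A \<times> A \<subseteq> G" using part_gauge by blast
  then show ?thesis
    unfolding coarsely_bounded_def using part_subset[OF A] subset_closed[OF gauge_in] by blast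
qed

lemma has_sum_ind: "((\<lambda>A. ind A v) has_sum v) P"
  using partition by (simp add: discrete_partition_def)

lemma measurableI: "C \<subseteq> X \<Longrightarrow> (\<And>A. A \<in> P \<Longrightarrow> C \<inter> A \<in> \<A>) \<Longrightarrow> C \<in> \<A>"
  using partition by (simp add: discrete_partition_def)

lemma Union_Int_part: "Q \<subseteq> P \<Longrightarrow> A \<in> P \<Longrightarrow> \<Union>Q \<inter> A = (if A \<in> Q then A else {})"
  by (cases "A \<in> Q") (use part_disjoint[of _ A] in \<open>simp_all, blast+\<close>)

lemma Union_measurable:
  assumes "Q \<subseteq> P" shows "\<Union>Q \<in> \<A>"
proof (rule measurableI)
  show "\<Union>Q \<subseteq> X" using assms part_subset by blast
  show "\<Union>Q \<inter> A \<in> \<A>" if "A \<in> P" for A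
    using assms that by (simp add: Union_Int_part part_measurable)
qed

lemma ind_part_Union:
  assumes "Q \<subseteq> P" "A \<in> P"
  shows "ind A (ind (\<Union>Q) v) = (if A \<in> Q then ind A v else 0)"
  using assms by (simp add: ind_ind part_measurable Union_measurable Int_commute[of A] Union_Int_part ind_empty)

section \<open>Decompositions along parts and along blocks of parts\<close>

lemma vector_eqI:
  assumes "\<And>A. A \<in> P \<Longrightarrow> ind A u = ind A w" shows "u = w"
proof -
  have "((\<lambda>A. ind A u) has_sum w) P"
    using has_sum_ind[of w] assms by (simp cong: has_sum_cong)
  then show ?thesis
    using has_sum_ind[of u] has_sum_unique by blast
qed

lemma has_sum_blinfun:
  fixes t :: "'h \<Rightarrow>\<^sub>L 'h"
  shows "((\<lambda>A. t (ind A v)) has_sum t v) P"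
  by (rule has_sum_bounded_linear[OF blinfun.bounded_linear_right has_sum_ind])

lemma operator_eqI:
  fixes s t :: "'h \<Rightarrow>\<^sub>L 'h"
  assumes "\<And>A v. A \<in> P \<Longrightarrow> s (ind A v) = t (ind A v)" shows "s = t"
proof (rule blinfun_eqI)
  fix v
  have "((\<lambda>A. s (ind A v)) has_sum t v) P"
    using has_sum_blinfun[of t v] assms by (simp cong: has_sum_cong)
  then show "s v = t v"
    using has_sum_blinfun[of s v] has_sum_unique by blast
qed

text \<open>The labelling \<open>j\<close> is arbitrary: its values are members of a locally finite
  partition in the coarsening, and connected components in the norm estimate.\<close>

definition block :: "('x set \<Rightarrow> 'b) \<Rightarrow> 'b \<Rightarrow> 'x set" where
  "block j b = \<Union>{A \<in> P. j A = b}"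

lemma block_measurable: "block j b \<in> \<A>"
  unfolding block_def by (rule Union_measurable) blast

lemma has_sum_ind_within_block:
  "((\<lambda>A. ind A v) has_sum ind (block j b) v) {A \<in> P. j A = b}"
proof -
  have "((\<lambda>A. ind A (ind (block j b) v)) has_sum ind (block j b) v) P"
    by (rule has_sum_ind)
  then show ?thesis
    by (rule has_sum_cong_neutral[THEN iffD1, rotated -1])
      (auto simp: block_def ind_part_Union)
qed

text \<open>The sum over all parts is regrouped along the fibres of \<open>j\<close>; each inner sum
  is already known.\<close>

lemma has_sum_ind_block: "((\<lambda>b. ind (block j b) v) has_sum v) (j ` P)"
proof -
  have "((\<lambda>(b, A). ind A v) has_sum v) (Sigma (j ` P) (\<lambda>b. {A \<in> P. j A = b}))"
    using has_sum_ind[of v]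
    by (subst has_sum_reindex_bij_witness[where i="\<lambda>A. (j A, A)" and j=snd and T=P and h="\<lambda>A. ind A v"])
      auto
  then show ?thesis
    by (rule has_sum_Sigma[OF isUCont_plus]) (simp add: has_sum_ind_within_block)
qed

text \<open>Parseval, by pairing the convergent block decomposition of \<open>v\<close> with
  \<open>v\<close> itself.\<close>

lemma has_sum_norm_block: "((\<lambda>b. (norm (ind (block j b) v))\<^sup>2) has_sum (norm v)\<^sup>2) (j ` P)"
proof -
  have "((\<lambda>b. inner (ind (block j b) v) v) has_sum inner v v) (j ` P)"
    by (rule has_sum_bounded_linear[OF bounded_linear_inner_left has_sum_ind_block])
  moreover have "inner (ind (block j b) v) v = (norm (ind (block j b) v))\<^sup>2" for b
    using ind_projection[OF block_measurable, of j b]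
    by (metis is_projectionD(2,4) power2_norm_eq_inner)
  ultimately show ?thesis
    by (simp add: power2_norm_eq_inner[of v])
qed

lemma has_sum_norm_ind: "((\<lambda>A. (norm (ind A v))\<^sup>2) has_sum (norm v)\<^sup>2) P"
proof -
  have "block (\<lambda>A. A) A = A" if "A \<in> P" for A
    using that by (auto simp: block_def)
  then show ?thesis
    using has_sum_norm_block[of "\<lambda>A. A" v] by (subst (asm) image_ident) (simp cong: has_sum_cong)
qed

text \<open>Parseval for \<open>v\<close> and for \<open>u v\<close>, compared block by block. The
  number of blocks does not enter the bound, so uncountably many components cost nothing.\<close>

lemma norm_le_if_block_diagonal:
  fixes u :: "'h \<Rightarrow>\<^sub>L 'h"
  assumes "0 \<le> c"
    and comm: "\<And>b v. b \<in> j ` P \<Longrightarrow> u (ind (block j b) v) = ind (block j b) (u v)"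
    and le: "\<And>b v. b \<in> j ` P \<Longrightarrow> norm (u (ind (block j b) v)) \<le> c * norm (ind (block j b) v)"
  shows "norm u \<le> c"
proof (rule norm_blinfun_bound[OF \<open>0 \<le> c\<close>])
  fix v
  have "(norm (ind (block j b) (u v)))\<^sup>2 \<le> c\<^sup>2 * (norm (ind (block j b) v))\<^sup>2" if "b \<in> j ` P" for b
    using power_mono[OF le[OF that, of v], of 2] comm[OF that, of v] by (simp add: power_mult_distrib)
  then have "(norm (u v))\<^sup>2 \<le> c\<^sup>2 * (norm v)\<^sup>2"
    using has_sum_mono[OF has_sum_norm_block has_sum_cmult_right[OF has_sum_norm_block]] by blast
  then have "(norm (u v))\<^sup>2 \<le> (c * norm v)\<^sup>2"
    by (simp add: power_mult_distrib)
  then show "norm (u v) \<le> c * norm v"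
    by (rule power2_le_imp_le) (use \<open>0 \<le> c\<close> in simp)
qed

lemma block_subset: "block j b \<subseteq> X"
  using part_subset by (auto simp: block_def)

lemma mem_blockD:
  assumes "x \<in> block j b" "A \<in> P" "x \<in> A" shows "j A = b"
proof -
  obtain B where "B \<in> P" "j B = b" "x \<in> B"
    using assms(1) by (auto simp: block_def)
  moreover from this have "A = B"
    using part_disjoint[OF assms(2), of B] assms(3) by blast
  ultimately show ?thesis by simp
qed

lemma mem_blockI: "A \<in> P \<Longrightarrow> x \<in> A \<Longrightarrow> x \<in> block j (j A)"
  by (auto simp: block_def)

text \<open>Nonempty parts determine the label of their block; sums over labels can thus be
  rewritten as sums over the coarsened partition.\<close>

lemma inj_on_block: "inj_on (block j) (j ` P)"
proof (rule inj_onI)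
  fix b c assume "b \<in> j ` P" and eq: "block j b = block j c"
  then obtain A where A: "A \<in> P" "b = j A" by blast
  obtain x where x: "x \<in> A" using part_nonempty[OF A(1)] by blast
  have "x \<in> block j c" using mem_blockI[OF A(1) x, of j] eq A(2) by simp
  from mem_blockD[OF this A(1) x] show "b = c" using A(2) by simp
qed

lemma partition_on_blocks: "partition_on X (block j ` j ` P)"
proof (rule partition_onI)
  show "\<Union>(block j ` j ` P) = X"
  proof
    show "\<Union>(block j ` j ` P) \<subseteq> X" using block_subset[of j] by auto
    show "X \<subseteq> \<Union>(block j ` j ` P)"
    proof
      fix x assume "x \<in> X"
      then obtain A where "A \<in> P" "x \<in> A" using part_cover by blast
      then show "x \<in> \<Union>(block j ` j ` P)" using mem_blockI[of A x j] by auto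
    qed
  qed
  show "disjnt p q" if pq: "p \<in> block j ` j ` P" "q \<in> block j ` j ` P" "p \<noteq> q" for p q
  proof -
    obtain b c where bc: "p = block j b" "q = block j c" using pq by blast
    have False if x: "x \<in> p" "x \<in> q" for x
    proof -
      obtain A where A: "A \<in> P" "x \<in> A"
        using x bc block_subset[of j b] part_cover[of x] by auto
      have "x \<in> block j b" "x \<in> block j c" using x bc by simp_all
      then have "j A = b" "j A = c" using mem_blockD[of x j b A] mem_blockD[of x j c A] A by simp_all
      then show False using pq(3) bc by simp
    qed
    then show ?thesis by (auto simp: disjnt_def)
  qed
  show "{} \<notin> block j ` j ` P"
  proof
    assume "{} \<in> block j ` j ` P"
    then obtain A where A: "A \<in> P" "{} = block j (j A)" by (elim imageE) simp
    obtain x where "x \<in> A" using part_nonempty[OF A(1)] by blast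
    then show False using mem_blockI[OF A(1), of x j] A(2) by simp
  qed
qed

section \<open>Block diagonal operators and their propagation\<close>

definition block_diagonal :: "('h \<Rightarrow>\<^sub>L 'h) \<Rightarrow> bool" where
  "block_diagonal t \<longleftrightarrow> (\<forall>A\<in>P. \<forall>v. t (ind A v) = ind A (t v))"

lemma block_diagonal_Union:
  assumes "block_diagonal t" "Q \<subseteq> P"
  shows "t (ind (\<Union>Q) v) = ind (\<Union>Q) (t v)"
proof (rule vector_eqI)
  fix A assume A: "A \<in> P"
  then have comm: "t (ind A w) = ind A (t w)" for w
    using assms(1) by (simp add: block_diagonal_def)
  show "ind A (t (ind (\<Union>Q) v)) = ind A (ind (\<Union>Q) (t v))"
    using A by (simp add: comm[symmetric] ind_part_Union assms(2))
qed

text \<open>A block diagonal operator need not commute with \<open>ind A\<close> for every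
  measurable \<open>A\<close>, but it does so for unions of parts. Passing to the parts that meet
  \<open>A\<close> enlarges \<open>A\<close> by at most one \<open>G\<close>-neighbourhood.\<close>

definition saturation :: "'x set \<Rightarrow> 'x set" where
  "saturation A = \<Union>{C \<in> P. C \<inter> A \<noteq> {}}"

lemma saturation_measurable: "saturation A \<in> \<A>"
  unfolding saturation_def by (rule Union_measurable) blast

lemma subset_saturation: "A \<subseteq> X \<Longrightarrow> A \<subseteq> saturation A"
  using part_cover unfolding saturation_def by blast

lemma block_diagonal_saturation:
  assumes "block_diagonal t"
  shows "t (ind (saturation A) v) = ind (saturation A) (t v)"
  unfolding saturation_def by (rule block_diagonal_Union[OF assms]) blast

lemma measurable_subset: "A \<in> \<A> \<Longrightarrow> A \<subseteq> X"
  using sets_into_space by blast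

text \<open>\<open>p\<close> maps the range of \<open>ind A\<close> into that of
  \<open>ind (saturation A)\<close>, and every point of the saturation is \<open>G\<close>-related
  to a point of \<open>A\<close>.\<close>

lemma block_diagonal_supp_compose:
  assumes "block_diagonal p" "supp_within \<A> ind s E"
  shows "supp_within \<A> ind (s o\<^sub>L p) (E O G)"
  unfolding supp_within_def
proof (intro ballI impI)
  fix B A assume BA: "B \<in> \<A>" "A \<in> \<A>" and sep: "separated (E O G) B A"
  have "separated E B (saturation A)"
    using sep part_gauge unfolding separated_def saturation_def by blast
  then have "ind B o\<^sub>L s o\<^sub>L ind (saturation A) = 0"
    using assms(2) BA(1) saturation_measurable by (simp add: supp_within_def)
  then have 0: "ind B (s (ind (saturation A) w)) = 0" for w
    by (metis blinfun_apply_blinfun_compose blinfun.zero_left)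
  have "p (ind A v) = ind (saturation A) (p (ind A v))" for v
    using ind_ind_subset(2)[OF BA(2) saturation_measurable subset_saturation[OF measurable_subset[OF BA(2)]]]
    by (metis block_diagonal_saturation[OF assms(1)])
  then show "ind B o\<^sub>L (s o\<^sub>L p) o\<^sub>L ind A = 0"
    using 0 by (intro blinfun_eqI) (metis blinfun_apply_blinfun_compose blinfun.zero_left)
qed

text \<open>The identity is supported on the diagonal; composing it with \<open>p\<close> yields the
  gauge itself rather than some enlargement of it.\<close>

lemma block_diagonal_supp:
  assumes "block_diagonal p"
  shows "supp_within \<A> ind p G"
proof -
  have "supp_within \<A> ind id_blinfun (Id_on X)"
    unfolding supp_within_def
  proof (intro ballI impI)
    fix B A assume "B \<in> \<A>" "A \<in> \<A>" "separated (Id_on X) B A"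
    then have "B \<inter> A = {}"
      using measurable_subset unfolding separated_def by blast
    then show "ind B o\<^sub>L id_blinfun o\<^sub>L ind A = 0"
      using \<open>B \<in> \<A>\<close> \<open>A \<in> \<A>\<close> by (intro blinfun_eqI) (simp add: ind_ind_disjoint)
  qed
  then have "supp_within \<A> ind (id_blinfun o\<^sub>L p) (Id_on X O G)"
    by (rule block_diagonal_supp_compose[OF assms])
  moreover have "id_blinfun o\<^sub>L p = p" by (rule blinfun_eqI) simp
  moreover have "Id_on X O G = G"
    using subset_square[OF gauge_in] by blast
  ultimately show ?thesis by simp
qed

text \<open>Members of a locally finite controlled partition \<open>Q\<close> need not be
  measurable, so \<open>Q\<close> serves only for labels: every part of \<open>P\<close> chooses a
  member of \<open>Q\<close> that it meets, and parts with equal labels are merged.\<close>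

lemma locally_finite_coarsening:
  assumes "coarsely_locally_finite X \<E>"
  obtains G' P' where "gauge_of X \<E> G'" "discrete_partition X \<A> ind G' P'"
    "locally_finite_family X \<E> P'"
proof -
  obtain Q F where Q: "partition_on X Q" "locally_finite_family X \<E> Q"
    and F: "F \<in> \<E>" "\<And>B. B \<in> Q \<Longrightarrow> rel_bounded X F B"
    using assms by (auto simp: coarsely_locally_finite_def controlled_partition_def)
  have "\<exists>B\<in>Q. A \<inter> B \<noteq> {}" if "A \<in> P" for A
    using part_nonempty[OF that] part_subset[OF that] partition_onD1[OF Q(1)] by blast
  then obtain j where j: "\<And>A. A \<in> P \<Longrightarrow> j A \<in> Q" "\<And>A. A \<in> P \<Longrightarrow> A \<inter> j A \<noteq> {}"
    by metis
  define P' where "P' = block j ` j ` P"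
  \<comment> \<open>Two points of a merged block are joined by a step within a part to the label, a
    step within the label, and a step within a part back.\<close>
  define H where "H = G O F O G"
  define G' where "G' = H \<union> H\<inverse> \<union> Id_on X"
  have "H \<in> \<E>"
    unfolding H_def by (intro relcomp_closed gauge_in F)
  then have "gauge_of X \<E> G'"
    unfolding gauge_of_def G'_def by (auto simp: sym_def intro: Un_closed converse_closed diagonal)
  moreover have "discrete_partition X \<A> ind G' P'"
    unfolding discrete_partition_def
  proof (intro conjI allI impI ballI)
    show "partition_on X P'"
      unfolding P'_def by (rule partition_on_blocks)
    show "C \<in> \<A>" if "C \<in> P'" for C
      using that block_measurable by (auto simp: P'_def)
    show "rel_bounded X G' C" if C: "C \<in> P'" for C
    proof -
      obtain b where b: "b \<in> j ` P" "C = block j b"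
        using C by (auto simp: P'_def)
      have "(x, x') \<in> G'" if x: "x \<in> C" "x' \<in> C" for x x'
      proof -
        obtain A A' where A: "A \<in> P" "j A = b" "x \<in> A" and A': "A' \<in> P" "j A' = b" "x' \<in> A'"
          using x unfolding b block_def by blast
        obtain y y' where y: "y \<in> A" "y \<in> b" "y' \<in> A'" "y' \<in> b"
          using j(2)[OF A(1)] j(2)[OF A'(1)] A A' by blast
        have "(x, y) \<in> G" "(y', x') \<in> G"
          using part_gauge A A' y by blast+
        moreover have "(y, y') \<in> F"
          using F(2)[of b] j(1)[OF A(1)] A(2) y by (auto simp: rel_bounded_def)
        ultimately show ?thesis unfolding G'_def H_def by blast
      qed
      moreover have "C \<subseteq> X" using part_subset unfolding b block_def by blast
      ultimately show ?thesis unfolding rel_bounded_def by auto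
    qed
    show "((\<lambda>C. ind C v) has_sum v) P'" for v
      unfolding P'_def by (subst has_sum_reindex[OF inj_on_block]) (simp add: o_def has_sum_ind_block)
    show "C \<in> \<A>" if C: "C \<subseteq> X" "\<forall>D\<in>P'. C \<inter> D \<in> \<A>" for C
    proof (rule measurableI[OF C(1)])
      fix A assume A: "A \<in> P"
      have "block j (j A) \<in> P'" using A by (auto simp: P'_def)
      \<comment> \<open>A part lies in its own block, so cutting with the block first does not
        change the trace on the part.\<close>
      then have "C \<inter> block j (j A) \<inter> A \<in> \<A>"
        using C(2) part_measurable[OF A] by blast
      moreover have "C \<inter> block j (j A) \<inter> A = C \<inter> A"
        using A unfolding block_def by blast
      ultimately show "C \<inter> A \<in> \<A>" by simp
    qed
  qed
  moreover have "locally_finite_family X \<E> P'"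
    unfolding locally_finite_family_def
  proof (intro allI impI)
    fix K assume "coarsely_bounded X \<E> K"
    then have "finite {B \<in> Q. B \<inter> G `` K \<noteq> {}}"
      using Q(2) coarsely_bounded_Image gauge_in unfolding locally_finite_family_def by blast
    moreover have "{C \<in> P'. C \<inter> K \<noteq> {}} \<subseteq> block j ` {B \<in> Q. B \<inter> G `` K \<noteq> {}}"
    proof
      fix C assume "C \<in> {C \<in> P'. C \<inter> K \<noteq> {}}"
      then obtain x where "C \<in> P'" "x \<in> C" "x \<in> K" by blast
      then obtain b A where b: "C = block j b" and A: "A \<in> P" "j A = b" "x \<in> A"
        unfolding P'_def block_def by blast
      obtain y where "y \<in> A" "y \<in> b"
        using j(2)[OF A(1)] A(2) by blast
      moreover from this have "(x, y) \<in> G"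
        using part_gauge A by blast
      ultimately have "b \<inter> G `` K \<noteq> {}" using \<open>x \<in> K\<close> by blast
      then show "C \<in> block j ` {B \<in> Q. B \<inter> G `` K \<noteq> {}}"
        using b j(1)[OF A(1)] A(2) by blast
    qed
    ultimately show "finite {C \<in> P'. C \<inter> K \<noteq> {}}"
      using finite_surj by blast
  qed
  ultimately show ?thesis using that by blast
qed


section \<open>Assembled projections and the directed index set\<close>

lemma is_projection_ind_part: "A \<in> P \<Longrightarrow> is_projection (ind A)"
  by (simp add: ind_projection part_measurable)

lemma ind_part_part: "A \<in> P \<Longrightarrow> B \<in> P \<Longrightarrow> ind A (ind B v) = (if A = B then ind A v else 0)"
  using part_disjoint[of A B] by (simp add: ind_ind part_measurable ind_empty)

text \<open>Each \<open>f A\<close> is a contraction factoring through \<open>ind A\<close>, so the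
  vectors \<open>f A v\<close> are orthogonal and their squared norms are dominated by the Parseval
  series of \<open>v\<close>. Their sum is the assembled operator, and its linearity and idempotence
  can be tested on parts.\<close>

lemma assemble_projection:
  fixes f :: "'x set \<Rightarrow> 'h \<Rightarrow>\<^sub>L 'h"
  assumes proj: "\<And>A. A \<in> P \<Longrightarrow> is_projection (f A)"
    and left: "\<And>A. A \<in> P \<Longrightarrow> ind A o\<^sub>L f A = f A"
  obtains p where "is_projection p" "\<And>A v. A \<in> P \<Longrightarrow> p (ind A v) = f A v"
    "\<And>A v. A \<in> P \<Longrightarrow> ind A (p v) = f A v"
proof -
  have l: "ind A (f A v) = f A v" if "A \<in> P" for A v
    using left[OF that] by (metis blinfun_apply_blinfun_compose)
  have r: "f A (ind A v) = f A v" if "A \<in> P" for A v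
    using is_projection_absorb_comm[OF proj is_projection_ind_part left, OF that that that]
    by (metis blinfun_apply_blinfun_compose)
  have off: "ind B (f A v) = 0" if "A \<in> P" "B \<in> P" "A \<noteq> B" for A B v
    using l[OF that(1), of v] ind_part_part[OF that(2,1), of "f A v"] that(3) by simp
  have summ: "(\<lambda>A. f A v) summable_on P" for v
  proof (rule summable_on_orthogonal)
    fix A B assume AB: "A \<in> P" "B \<in> P" "A \<noteq> B"
    have "inner (f A v) (f B v) = inner (ind A (f A v)) (f B v)"
      using l[OF AB(1)] by simp
    also have "\<dots> = inner (f A v) (ind A (f B v))"
      by (rule is_projectionD(4)[OF is_projection_ind_part[OF AB(1)]])
    finally show "inner (f A v) (f B v) = 0"
      using off[OF AB(2,1)] AB(3) by simp
  next
    show "(\<lambda>A. (norm (f A v))\<^sup>2) summable_on P"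
    proof (rule summable_on_comparison_test)
      show "(\<lambda>A. (norm (ind A v))\<^sup>2) summable_on P"
        using has_sum_norm_ind has_sum_imp_summable by blast
      show "(norm (f A v))\<^sup>2 \<le> (norm (ind A v))\<^sup>2" if "A \<in> P" for A
        using is_projection_norm_le[OF proj[OF that], of "ind A v"] r[OF that] by (simp add: power_mono)
    qed simp
  qed
  define g where "g v = (\<Sum>\<^sub>\<infinity>A\<in>P. f A v)" for v
  have g: "((\<lambda>A. f A v) has_sum g v) P" for v
    unfolding g_def by (rule has_sum_infsum[OF summ])
  have ind_g: "ind A (g v) = f A v" if "A \<in> P" for A v
  proof -
    have "((\<lambda>B. ind A (f B v)) has_sum ind A (g v)) P"
      by (rule has_sum_bounded_linear[OF blinfun.bounded_linear_right g])
    moreover have "((\<lambda>B. ind A (f B v)) has_sum f A v) P"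
    proof (rule has_sum_cong_neutral[THEN iffD1])
      show "((\<lambda>B. f B v) has_sum f A v) {A}"
        using has_sum_finite[of "{A}" "\<lambda>B. f B v"] by simp
    qed (use that off l in auto)
    ultimately show ?thesis using has_sum_unique by blast
  qed
  have "bounded_linear g"
  proof (rule bounded_linear_intro)
    show "g (u + v) = g u + g v" for u v
      by (rule vector_eqI) (simp add: ind_g blinfun.add_right)
    show "g (c *\<^sub>R v) = c *\<^sub>R g v" for c v
      by (rule vector_eqI) (simp add: ind_g blinfun.scaleR_right)
    show "norm (g v) \<le> norm v * 1" for v
    proof -
      have "(norm (ind A (g v)))\<^sup>2 \<le> (norm (ind A v))\<^sup>2" if "A \<in> P" for A
        using is_projection_norm_le[OF proj[OF that], of "ind A v"] r[OF that] ind_g[OF that]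
        by (simp add: power_mono)
      then have "(norm (g v))\<^sup>2 \<le> (norm v)\<^sup>2"
        by (rule has_sum_mono[OF has_sum_norm_ind has_sum_norm_ind])
      then show ?thesis by simp
    qed
  qed
  define p where "p = Blinfun g"
  have pg: "blinfun_apply p = g"
    unfolding p_def by (rule bounded_linear_Blinfun_apply) fact
  have ind_p: "ind A (p v) = f A v" if "A \<in> P" for A v
    using ind_g[OF that] by (simp add: pg)
  have p_ind: "p (ind A v) = f A v" if A: "A \<in> P" for A v
  proof (rule vector_eqI)
    fix B assume B: "B \<in> P"
    have "f B (ind A v) = (if A = B then f A v else 0)"
    proof (cases "A = B")
      case True
      then show ?thesis using r[OF A] by simp
    next
      case False
      have "f B (ind A v) = f B (ind B (ind A v))"
        using r[OF B] by simp
      then show ?thesis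
        using False by (simp add: ind_part_part[OF B A])
    qed
    then show "ind B (p (ind A v)) = ind B (f A v)"
      using off[OF A B, of v] l[OF A, of v] by (auto simp: ind_p[OF B])
  qed
  have "is_projection p"
    unfolding is_projection_def
  proof (intro conjI allI)
    have "p (c *c v) = c *c p v" for c v
    proof (rule vector_eqI)
      fix A assume "A \<in> P"
      then show "ind A (p (c *c v)) = ind A (c *c p v)"
        using is_projectionD(1)[OF proj] is_projectionD(1)[OF is_projection_ind_part]
        by (simp add: ind_p cblinfuns_def)
    qed
    then show "p \<in> cblinfuns" by (simp add: cblinfuns_def)
    show "p o\<^sub>L p = p"
    proof (rule blinfun_eqI, rule vector_eqI)
      fix v A assume A: "A \<in> P"
      show "ind A ((p o\<^sub>L p) v) = ind A (p v)"
        using r[OF A, of "p v"] by (simp add: ind_p[OF A] is_projectionD(2)[OF proj[OF A]])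
    qed
    fix x y
    \<comment> \<open>Self-adjointness: both inner products are limits of the sums of
      \<open>cinner (f A x) y\<close>, the one with \<open>p y\<close> after conjugation.\<close>
    have s: "((\<lambda>A. cinner (f A u) w) has_sum cinner (p u) w) P" for u w
      unfolding pg by (rule has_sum_bounded_linear[OF bounded_linear_cinner_left g])
    have "((\<lambda>A. cnj (cinner (f A y) x)) has_sum cnj (cinner (p y) x)) P"
      by (rule has_sum_bounded_linear[OF bounded_linear_cnj s])
    moreover have "cnj (cinner (f A y) x) = cinner (f A x) y" if "A \<in> P" for A
      using is_projectionD(3)[OF proj[OF that]] cinner_commute by metis
    ultimately have "((\<lambda>A. cinner (f A x) y) has_sum cnj (cinner (p y) x)) P"
      by (simp cong: has_sum_cong)
    then have "((\<lambda>A. cinner (f A x) y) has_sum cinner x (p y)) P"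
      unfolding cinner_commute[of x "p y"] .
    then show "cinner (p x) y = cinner x (p y)"
      using s has_sum_unique by blast
  qed
  then show ?thesis using that p_ind ind_p by blast
qed

text \<open>Finite rank is imposed on single parts; local finiteness of the partition carries it
  over to bounded sets. No operator to be approximated enters.\<close>

definition lf_projections :: "('h \<Rightarrow>\<^sub>L 'h) set" where
  "lf_projections = {p. is_projection p \<and> block_diagonal p \<and> (\<forall>A\<in>P. finite_rank (p o\<^sub>L ind A))}"

text \<open>A demand on projections, recorded as vectors to be fixed. Confining the vectors to the
  range of \<open>ind A\<close> lets the demands for different parts be met independently.\<close>

definition part_vectors :: "('x set \<Rightarrow> 'h set) \<Rightarrow> bool" where
  "part_vectors S \<longleftrightarrow> (\<forall>A\<in>P. finite (S A) \<and> (\<forall>x\<in>S A. ind A x = x))"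

definition fixes_vectors :: "('h \<Rightarrow>\<^sub>L 'h) \<Rightarrow> ('x set \<Rightarrow> 'h set) \<Rightarrow> bool" where
  "fixes_vectors q S \<longleftrightarrow> (\<forall>A\<in>P. \<forall>x\<in>S A. q x = x)"

lemma part_vectors_Un: "part_vectors S \<Longrightarrow> part_vectors T \<Longrightarrow> part_vectors (\<lambda>A. S A \<union> T A)"
  by (auto simp: part_vectors_def)

lemma fixes_vectors_Un: "fixes_vectors q (\<lambda>A. S A \<union> T A) \<longleftrightarrow> fixes_vectors q S \<and> fixes_vectors q T"
  by (auto simp: fixes_vectors_def)

text \<open>On each part take the projection onto the span of the prescribed vectors; it lies below
  \<open>ind A\<close> since \<open>ind A\<close> fixes them, so these projections can be
  assembled.\<close>

lemma lf_projection_fixing: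
  assumes "part_vectors S"
  obtains p where "p \<in> lf_projections" "fixes_vectors p S"
proof -
  have "\<exists>q. is_projection q \<and> range (blinfun_apply q) = complex_vector.span (S A)" if "A \<in> P" for A
    using span_projection[of "S A"] assms that unfolding part_vectors_def by metis
  then obtain f where f: "\<And>A. A \<in> P \<Longrightarrow> is_projection (f A)"
    "\<And>A. A \<in> P \<Longrightarrow> range (blinfun_apply (f A)) = complex_vector.span (S A)"
    by metis
  have "ind A o\<^sub>L f A = f A" if A: "A \<in> P" for A
  proof (rule blinfun_eqI)
    fix v
    have "f A v \<in> complex_vector.span (S A)" using f(2)[OF A] by blast
    then show "(ind A o\<^sub>L f A) v = f A v"
      using cblinfuns_fix_span[OF is_projectionD(1)[OF is_projection_ind_part[OF A]], of "S A"] assms A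
      by (simp add: part_vectors_def)
  qed
  then obtain p where p: "is_projection p" "\<And>A v. A \<in> P \<Longrightarrow> p (ind A v) = f A v"
    "\<And>A v. A \<in> P \<Longrightarrow> ind A (p v) = f A v"
    using assemble_projection[of f] f(1) by metis
  have "finite_rank (p o\<^sub>L ind A)" if A: "A \<in> P" for A
    unfolding finite_rank_def
    using f(2)[OF A] assms A by (intro exI[of _ "S A"]) (auto simp: p part_vectors_def)
  then have "p \<in> lf_projections"
    unfolding lf_projections_def using p by (simp add: block_diagonal_def)
  moreover have "fixes_vectors p S"
    unfolding fixes_vectors_def
  proof (intro ballI)
    fix A x assume A: "A \<in> P" "x \<in> S A"
    then have "x \<in> range (blinfun_apply (f A))"
      by (simp add: f(2) complex_vector.span_base)
    then have "f A x = x"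
      using is_projectionD(2)[OF f(1)[OF A(1)]] by (metis imageE)
    then show "p x = x"
      using p(2)[OF A(1), of x] assms A by (simp add: part_vectors_def)
  qed
  ultimately show ?thesis using that by blast
qed

text \<open>On each part the range of \<open>p\<close> is spanned by finitely many vectors; a
  projection fixing these fixes the range of \<open>p\<close>.\<close>

lemma lf_projection_dominated:
  assumes p: "p \<in> lf_projections"
  obtains S where "part_vectors S"
    "\<And>r. r \<in> lf_projections \<Longrightarrow> fixes_vectors r S \<Longrightarrow> r o\<^sub>L p = p"
proof -
  have proj: "is_projection p" and comm: "\<And>A v. A \<in> P \<Longrightarrow> p (ind A v) = ind A (p v)"
    and "\<And>A. A \<in> P \<Longrightarrow> finite_rank (p o\<^sub>L ind A)"
    using p by (auto simp: lf_projections_def block_diagonal_def)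
  then obtain T where T: "\<And>A. A \<in> P \<Longrightarrow> finite (T A)"
    "\<And>A. A \<in> P \<Longrightarrow> range (blinfun_apply (p o\<^sub>L ind A)) \<subseteq> complex_vector.span (T A)"
    unfolding finite_rank_def by metis
  \<comment> \<open>The spanning set \<open>T A\<close> may leave the range of
    \<open>p o\<^sub>L ind A\<close>. Applying this idempotent moves it into the range without
    losing the spanning property.\<close>
  define S where "S A = blinfun_apply (p o\<^sub>L ind A) ` T A" for A
  have "part_vectors S"
    unfolding part_vectors_def
  proof (intro ballI conjI)
    fix A assume A: "A \<in> P"
    then show "finite (S A)" by (simp add: S_def T)
    fix x assume "x \<in> S A"
    then obtain w where "x = p (ind A w)" by (auto simp: S_def)
    then show "ind A x = x"
      by (simp add: comm[OF A, symmetric] ind_part_part[OF A A])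
  qed
  moreover have "r o\<^sub>L p = p" if r: "r \<in> lf_projections" "fixes_vectors r S" for r
  proof (rule operator_eqI)
    fix A v assume A: "A \<in> P"
    have "p (ind A v) \<in> complex_vector.span (T A)"
      using T(2)[OF A] by auto
    moreover have "p o\<^sub>L ind A \<in> cblinfuns"
      using is_projectionD(1)[OF proj] is_projectionD(1)[OF is_projection_ind_part[OF A]]
      by (rule cblinfuns_compose)
    ultimately have "(p o\<^sub>L ind A) (p (ind A v)) \<in> complex_vector.span (S A)"
      unfolding S_def by (intro cblinfuns_image_span)
    moreover have "(p o\<^sub>L ind A) (p (ind A v)) = p (ind A v)"
      by (simp add: comm[OF A, symmetric] ind_part_part[OF A A] is_projectionD(2)[OF proj])
    ultimately have "p (ind A v) \<in> complex_vector.span (S A)" by simp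
    moreover have "r \<in> cblinfuns"
      using r(1) by (simp add: lf_projections_def is_projectionD(1))
    ultimately have "r (p (ind A v)) = p (ind A v)"
      using cblinfuns_fix_span[of r "S A"] r(2) A by (simp add: fixes_vectors_def)
    then show "(r o\<^sub>L p) (ind A v) = p (ind A v)" by simp
  qed
  ultimately show ?thesis using that by blast
qed

text \<open>An upper bound of \<open>p\<close> and \<open>q\<close> is any member that fixes the
  vectors dominating both.\<close>

lemma lf_projections_directed:
  "directed_by lf_projections (\<lambda>p q. q o\<^sub>L p = p)"
  unfolding directed_by_def
proof (intro conjI ballI)
  have "part_vectors (\<lambda>A. {})" by (simp add: part_vectors_def)
  then show "lf_projections \<noteq> {}" using lf_projection_fixing by blast
  show "reflp_on lf_projections (\<lambda>p q. q o\<^sub>L p = p)"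
    by (rule reflp_onI) (simp add: lf_projections_def is_projection_def)
  show "transp_on lf_projections (\<lambda>p q. q o\<^sub>L p = p)"
    by (rule transp_onI) (metis blinfun_compose_assoc)
  fix p q assume "p \<in> lf_projections" "q \<in> lf_projections"
  then obtain S T where S: "part_vectors S"
      "\<And>r. r \<in> lf_projections \<Longrightarrow> fixes_vectors r S \<Longrightarrow> r o\<^sub>L p = p"
    and T: "part_vectors T"
      "\<And>r. r \<in> lf_projections \<Longrightarrow> fixes_vectors r T \<Longrightarrow> r o\<^sub>L q = q"
    using lf_projection_dominated by metis
  obtain r where "r \<in> lf_projections" "fixes_vectors r (\<lambda>A. S A \<union> T A)"
    using lf_projection_fixing[OF part_vectors_Un[OF S(1) T(1)]] .
  then show "\<exists>r\<in>lf_projections. r o\<^sub>L p = p \<and> r o\<^sub>L q = q"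
    using S(2) T(2) by (intro bexI[of _ r]) (simp_all add: fixes_vectors_Un)
qed

end

section \<open>Locally finite discrete partitions\<close>

locale locally_finite_module = partitioned_module X \<E> \<A> ind G P
  for X :: "'x set" and \<E> \<A> and ind :: "'x set \<Rightarrow> 'h::chilbert_space \<Rightarrow>\<^sub>L 'h" and G P +
  assumes locally_finite: "locally_finite_family X \<E> P"
begin

lemma finite_rank_ind_Union:
  assumes p: "p \<in> lf_projections" and "finite Q" "Q \<subseteq> P"
  shows "finite_rank (p o\<^sub>L ind (\<Union>Q))"
  using assms(2,3)
proof (induction Q)
  case empty
  have "p o\<^sub>L ind {} = 0" by (rule blinfun_eqI) (simp add: ind_empty)
  then show ?case by (simp add: finite_rank_zero)
next
  case (insert A Q)
  then have A: "A \<in> P" "Q \<subseteq> P" by auto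
  have "A \<inter> \<Union>Q = {}" using part_disjoint[OF A(1)] insert.hyps(2) A(2) by blast
  then have "ind (A \<union> \<Union>Q) v = ind A v + ind (\<Union>Q) v" for v
    using ind_Un[OF part_measurable[OF A(1)] Union_measurable[OF A(2)]]
      ind_ind_disjoint[OF part_measurable[OF A(1)] Union_measurable[OF A(2)]]
    by (simp add: blinfun.add_left blinfun.diff_left)
  then have "p o\<^sub>L ind (\<Union>(insert A Q)) = (p o\<^sub>L ind A) + (p o\<^sub>L ind (\<Union>Q))"
    by (intro blinfun_eqI) (simp add: blinfun.add_left blinfun.add_right)
  moreover have "finite_rank (p o\<^sub>L ind A)" using p A(1) by (simp add: lf_projections_def)
  ultimately show ?case
    using insert.IH[OF A(2)] by (simp add: finite_rank_add)
qed

lemma finite_rank_saturation: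
  assumes "p \<in> lf_projections" "coarsely_bounded X \<E> K"
  shows "finite_rank (p o\<^sub>L ind (saturation K))"
  unfolding saturation_def
  by (rule finite_rank_ind_Union) (use assms locally_finite in \<open>auto simp: locally_finite_family_def\<close>)

text \<open>\<open>p\<close> commutes with the projection of the saturation of \<open>K\<close>, a
  finite union of parts, so both products factor through
  \<open>p o\<^sub>L ind (saturation K)\<close>.\<close>

lemma lf_projections_locally_finite_rank:
  assumes p: "p \<in> lf_projections"
  shows "locally_finite_rank X \<E> \<A> ind p"
  unfolding locally_finite_rank_def
proof (intro ballI impI conjI)
  fix K assume K: "K \<in> \<A>" "coarsely_bounded X \<E> K"
  have bd: "block_diagonal p" using p by (simp add: lf_projections_def)
  note fr = finite_rank_saturation[OF p K(2)]
  note sub = ind_ind_subset[OF K(1) saturation_measurable subset_saturation[OF measurable_subset[OF K(1)]]]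
  have "ind K o\<^sub>L p = ind K o\<^sub>L (p o\<^sub>L ind (saturation K))"
    by (rule blinfun_eqI) (simp add: block_diagonal_saturation[OF bd] sub)
  then show "finite_rank (ind K o\<^sub>L p)"
    using fr ind_projection[OF K(1)] by (simp add: finite_rank_compose_left is_projectionD(1))
  have "p o\<^sub>L ind K = (p o\<^sub>L ind (saturation K)) o\<^sub>L ind K"
    by (rule blinfun_eqI) (simp add: sub)
  then show "finite_rank (p o\<^sub>L ind K)"
    using fr by (simp add: finite_rank_compose_right)
qed

text \<open>Multiplying by \<open>p\<close> makes a controlled operator locally compact at the cost
  of one further \<open>G\<close>-step of propagation; this produces the elements of the Roe algebra
  near a given operator.\<close>

lemma compose_lf_projection_in_Roe_alg:
  assumes s: "s \<in> cblinfuns" "controlled_propagation \<E> \<A> ind s" and p: "p \<in> lf_projections"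
  shows "s o\<^sub>L p \<in> Roe_alg X \<E> \<A> ind"
proof -
  have proj: "is_projection p" and bd: "block_diagonal p"
    using p by (simp_all add: lf_projections_def)
  obtain E where E: "E \<in> \<E>" "supp_within \<A> ind s E"
    using s(2) by (auto simp: controlled_propagation_def)
  have "locally_compact_op X \<E> \<A> ind (s o\<^sub>L p)"
    unfolding locally_compact_op_def
  proof (intro ballI impI conjI)
    fix K assume K: "K \<in> \<A>" "coarsely_bounded X \<E> K"
    have "compact_op (s o\<^sub>L (p o\<^sub>L ind K))"
      using lf_projections_locally_finite_rank[OF p] K
      by (simp add: locally_finite_rank_def compact_op_compose_left finite_rank_imp_compact_op)
    then show "compact_op ((s o\<^sub>L p) o\<^sub>L ind K)"
      by (simp add: blinfun_compose_assoc)
    define L where "L = saturation (E `` K)"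
    have L: "L \<in> \<A>" unfolding L_def by (rule saturation_measurable)
    have sub: "E `` K \<subseteq> L"
      unfolding L_def using subset_square[OF E(1)] by (intro subset_saturation) blast
    have "separated E K (X - L)"
      using sub unfolding separated_def by blast
    then have "ind K o\<^sub>L s o\<^sub>L ind (X - L) = 0"
      using E(2) K(1) L unfolding supp_within_def by blast
    then have "ind K (s (ind (X - L) v)) = 0" for v
      by (metis blinfun_apply_blinfun_compose blinfun.zero_left)
    then have "ind K (s (v - ind L v)) = 0" for v
      unfolding ind_Diff_whole[OF L, symmetric] .
    then have "ind K (s (p v)) = ind K (s (ind L (p v)))" for v
      by (simp add: blinfun.diff_right)
    moreover have "ind L (p v) = p (ind L v)" for v
      unfolding L_def by (simp add: block_diagonal_saturation[OF bd])
    ultimately have "ind K o\<^sub>L (s o\<^sub>L p) = (ind K o\<^sub>L s) o\<^sub>L (p o\<^sub>L ind L)"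
      by (intro blinfun_eqI) simp
    moreover have "compact_op (p o\<^sub>L ind L)"
      unfolding L_def
      by (intro finite_rank_imp_compact_op finite_rank_saturation p coarsely_bounded_Image K E)
    ultimately show "compact_op (ind K o\<^sub>L (s o\<^sub>L p))"
      by (simp add: compact_op_compose_left)
  qed
  moreover have "controlled_propagation \<E> \<A> ind (s o\<^sub>L p)"
    unfolding controlled_propagation_def
    using block_diagonal_supp_compose[OF bd E(2)] relcomp_closed[OF E(1) gauge_in] by blast
  moreover have "s o\<^sub>L p \<in> cblinfuns"
    using s(1) is_projectionD(1)[OF proj] by (rule cblinfuns_compose)
  ultimately show ?thesis by (simp add: Roe_alg_def)
qed

lemma lf_projections_in_Roe_alg: "p \<in> lf_projections \<Longrightarrow> p \<in> Roe_alg X \<E> \<A> ind"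
  using lf_projections_locally_finite_rank[of p] block_diagonal_supp[of p] gauge_in
  by (auto simp: Roe_alg_def locally_compact_op_def locally_finite_rank_def lf_projections_def
      controlled_propagation_def finite_rank_imp_compact_op is_projectionD(1))

section \<open>Countable components and the norm estimates\<close>

lemma finite_meeting_parts:
  assumes "A \<in> P" "E \<in> \<E>"
  shows "finite {B \<in> P. B \<inter> (E `` A \<union> E\<inverse> `` A) \<noteq> {}}"
proof -
  have "E \<union> E\<inverse> \<in> \<E>" using assms(2) by (intro Un_closed converse_closed)
  then have "coarsely_bounded X \<E> ((E \<union> E\<inverse>) `` A)"
    by (rule coarsely_bounded_Image[OF part_bounded[OF assms(1)]])
  then have "finite {B \<in> P. B \<inter> ((E \<union> E\<inverse>) `` A) \<noteq> {}}"
    using locally_finite by (simp add: locally_finite_family_def)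
  then show ?thesis by (simp add: Un_Image)
qed

text \<open>Both off-diagonal corners of \<open>s\<close> with respect to \<open>Y\<close> and its
  complement vanish.\<close>

lemma supp_within_commutes:
  assumes "supp_within \<A> ind s E" "Y \<in> \<A>" "separated E Y (X - Y)" "separated E (X - Y) Y"
  shows "s (ind Y v) = ind Y (s v)"
proof -
  have "X - Y \<in> \<A>" using assms(2) by blast
  then have "ind Y o\<^sub>L s o\<^sub>L ind (X - Y) = 0" "ind (X - Y) o\<^sub>L s o\<^sub>L ind Y = 0"
    using assms by (simp_all add: supp_within_def)
  then have "ind Y (s (ind (X - Y) v)) = 0" "ind (X - Y) (s (ind Y v)) = 0"
    by (metis blinfun_apply_blinfun_compose blinfun.zero_left)+
  then show ?thesis
    unfolding ind_Diff_whole[OF assms(2)] by (simp add: blinfun.diff_right)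
qed

text \<open>Join two parts when they are related by one of the countably many controlled sets supporting
  a sequence of operators tending to \<open>t\<close>. Local finiteness makes this graph locally countable, so its
  components are countable, and no approximating operator connects different components.\<close>

lemma countable_components:
  assumes "t \<in> Cstar_cp \<E> \<A> ind"
  obtains j :: "'x set \<Rightarrow> 'x set set" where
    "\<And>b. b \<in> j ` P \<Longrightarrow> countable {A \<in> P. j A = b}"
    "\<And>b v. b \<in> j ` P \<Longrightarrow> t (ind (block j b) v) = ind (block j b) (t v)"
proof -
  obtain s where s: "\<And>n::nat. controlled_propagation \<E> \<A> ind (s n)" "s \<longlonglongrightarrow> t"
    using assms unfolding Cstar_cp_def closure_sequential by blast
  then obtain E where E: "\<And>n. E n \<in> \<E>" "\<And>n. supp_within \<A> ind (s n) (E n)"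
    unfolding controlled_propagation_def by metis
  define R where "R = {(A, B). A \<in> P \<and> B \<in> P \<and> (\<exists>n. B \<inter> (E n `` A \<union> (E n)\<inverse> `` A) \<noteq> {})}"
  have "sym R"
    by (rule symI) (auto simp: R_def)
  then have symR: "sym (R\<^sup>*)" by (rule sym_rtrancl)
  define j where "j A = R\<^sup>* `` {A}" for A
  have j_eq: "j A = j B" if "(A, B) \<in> R" for A B
  proof -
    have "(A, B) \<in> R\<^sup>*" "(B, A) \<in> R\<^sup>*"
      using that symR by (auto dest: symD)
    then show ?thesis unfolding j_def by (auto intro: rtrancl_trans)
  qed
  have "countable (R `` {A})" for A
  proof (cases "A \<in> P")
    case True
    have "R `` {A} \<subseteq> (\<Union>n. {B \<in> P. B \<inter> (E n `` A \<union> (E n)\<inverse> `` A) \<noteq> {}})"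
      by (auto simp: R_def)
    moreover have "countable (\<Union>n. {B \<in> P. B \<inter> (E n `` A \<union> (E n)\<inverse> `` A) \<noteq> {}})"
      by (intro countable_UN countableI_type countable_finite finite_meeting_parts True E)
    ultimately show ?thesis by (rule countable_subset)
  next
    case False
    then have "R `` {A} = {}" by (auto simp: R_def)
    then show ?thesis by simp
  qed
  then have "countable (R `` Y)" if "countable Y" for Y
    using that unfolding Image_eq_UN[of R Y] by (intro countable_UN)
  then have count: "countable (R\<^sup>* `` {A})" for A
    by (intro countable_rtrancl) auto
  show ?thesis
  proof (rule that[of j])
    fix b assume "b \<in> j ` P"
    then obtain A where A: "A \<in> P" "b = j A" by blast
    \<comment> \<open>\<open>B\<close> lies in its own class \<open>j B\<close> by reflexivity, so
      an equal label puts it into the class of \<open>A\<close>.\<close>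
    have "{B \<in> P. j B = b} \<subseteq> R\<^sup>* `` {A}"
      unfolding A(2) by (auto simp: j_def)
    then show "countable {B \<in> P. j B = b}"
      using count countable_subset by blast
    fix v
    let ?Y = "block j b"
    have Y: "?Y \<in> \<A>" by (rule block_measurable)
    have no_edge: False if xy: "x \<in> ?Y" "y \<in> X - ?Y" "(x, y) \<in> E n \<or> (y, x) \<in> E n" for x y n
    proof -
      obtain A where A: "A \<in> P" "x \<in> A"
        using xy(1) block_subset[of j b] part_cover[of x] by auto
      obtain B where B: "B \<in> P" "y \<in> B"
        using xy(2) part_cover[of y] by auto
      have "(A, B) \<in> R"
        using A B xy(3) by (auto simp: R_def)
      then have "j B = b"
        using j_eq[of A B] mem_blockD[OF xy(1) A] by simp
      then show False
        using mem_blockI[OF B, of j] xy(2) by simp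
    qed
    \<comment> \<open>Commutation is exact for every approximant and so passes to the limit,
      although \<open>t\<close> itself may have no controlled support.\<close>
    have "s n (ind ?Y v) = ind ?Y (s n v)" for n
    proof (rule supp_within_commutes[OF E(2) Y])
      show "separated (E n) ?Y (X - ?Y)" "separated (E n) (X - ?Y) ?Y"
        unfolding separated_def using no_edge[of _ _ n] by auto
    qed
    moreover have "(\<lambda>n. s n (ind ?Y v)) \<longlonglongrightarrow> t (ind ?Y v)"
      by (intro tendsto_intros s)
    moreover have "(\<lambda>n. ind ?Y (s n v)) \<longlonglongrightarrow> ind ?Y (t v)"
      by (intro tendsto_intros s)
    ultimately show "t (ind ?Y v) = ind ?Y (t v)"
      by (simp add: LIMSEQ_unique)
  qed
qed

text \<open>The accuracy \<open>d\<close> may vary with the part, which leaves room for making it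
  summable along components. One set handles both sides: the union of the vectors for
  \<open>ind A o\<^sub>L t\<close> and for \<open>t o\<^sub>L ind A\<close>.\<close>

lemma approximating_vectors:
  fixes d :: "'x set \<Rightarrow> real"
  assumes t: "locally_compact_op X \<E> \<A> ind t" and d: "\<And>A. d A > 0"
  obtains S where "part_vectors S"
    "\<And>q A. is_projection q \<Longrightarrow> fixes_vectors q S \<Longrightarrow> A \<in> P \<Longrightarrow>
       norm ((ind A o\<^sub>L t) - (q o\<^sub>L (ind A o\<^sub>L t))) \<le> d A \<and>
       norm ((t o\<^sub>L ind A) - ((t o\<^sub>L ind A) o\<^sub>L q)) \<le> d A"
proof -
  have ex: "\<exists>S. finite S \<and> (\<forall>x\<in>S. ind A x = x) \<and>
      (\<forall>q. is_projection q \<longrightarrow> (\<forall>x\<in>S. q x = x) \<longrightarrow>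
        norm ((ind A o\<^sub>L t) - (q o\<^sub>L (ind A o\<^sub>L t))) \<le> d A \<and>
        norm ((t o\<^sub>L ind A) - ((t o\<^sub>L ind A) o\<^sub>L q)) \<le> d A)" if A: "A \<in> P" for A
  proof -
    have cpt: "compact_op (ind A o\<^sub>L t)" "compact_op (t o\<^sub>L ind A)"
      using t part_measurable[OF A] part_bounded[OF A] by (simp_all add: locally_compact_op_def)
    have e: "is_projection (ind A)" by (rule is_projection_ind_part[OF A])
    have absorb: "ind A o\<^sub>L (ind A o\<^sub>L t) = ind A o\<^sub>L t" "(t o\<^sub>L ind A) o\<^sub>L ind A = t o\<^sub>L ind A"
      by (rule blinfun_eqI, simp add: is_projectionD(2)[OF e])+
    obtain S where S: "finite S" "\<And>x. x \<in> S \<Longrightarrow> ind A x = x"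
      "\<And>q. is_projection q \<Longrightarrow> (\<And>x. x \<in> S \<Longrightarrow> blinfun_apply q x = x) \<Longrightarrow>
        norm ((ind A o\<^sub>L t) - (q o\<^sub>L (ind A o\<^sub>L t))) \<le> d A"
      using compact_op_approx_left[OF cpt(1) e absorb(1) d[of A]] by metis
    obtain T where T: "finite T" "\<And>x. x \<in> T \<Longrightarrow> ind A x = x"
      "\<And>q. is_projection q \<Longrightarrow> (\<And>x. x \<in> T \<Longrightarrow> blinfun_apply q x = x) \<Longrightarrow>
        norm ((t o\<^sub>L ind A) - ((t o\<^sub>L ind A) o\<^sub>L q)) \<le> d A"
      using compact_op_approx_right[OF cpt(2) e absorb(2) d[of A]] by metis
    show ?thesis
    proof (intro exI[of _ "S \<union> T"] conjI ballI allI impI)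
      show "finite (S \<union> T)" using S(1) T(1) by simp
      show "ind A x = x" if "x \<in> S \<union> T" for x using that S(2) T(2) by auto
      fix q :: "'h \<Rightarrow>\<^sub>L 'h" assume q: "is_projection q" "\<forall>x\<in>S \<union> T. q x = x"
      show "norm ((ind A o\<^sub>L t) - (q o\<^sub>L (ind A o\<^sub>L t))) \<le> d A"
        using q by (intro S(3)) auto
      show "norm ((t o\<^sub>L ind A) - ((t o\<^sub>L ind A) o\<^sub>L q)) \<le> d A"
        using q by (intro T(3)) auto
    qed
  qed
  then obtain S where S: "\<forall>A\<in>P. finite (S A) \<and> (\<forall>x\<in>S A. ind A x = x) \<and>
      (\<forall>q. is_projection q \<longrightarrow> (\<forall>x\<in>S A. q x = x) \<longrightarrow>
        norm ((ind A o\<^sub>L t) - (q o\<^sub>L (ind A o\<^sub>L t))) \<le> d A \<and>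
        norm ((t o\<^sub>L ind A) - ((t o\<^sub>L ind A) o\<^sub>L q)) \<le> d A)"
    by metis
  show ?thesis
    by (rule that[of S]) (use S in \<open>auto simp: part_vectors_def fixes_vectors_def\<close>)
qed

lemma lf_projection_approximates:
  assumes t: "t \<in> Cstar_cp \<E> \<A> ind \<inter> Cstar_lc X \<E> \<A> ind" and "\<epsilon> > 0"
  obtains S where "part_vectors S"
    "\<And>q. q \<in> lf_projections \<Longrightarrow> fixes_vectors q S \<Longrightarrow>
       norm (t - (q o\<^sub>L t)) \<le> \<epsilon> \<and> norm (t - (t o\<^sub>L q)) \<le> \<epsilon>"
proof -
  obtain j :: "'x set \<Rightarrow> 'x set set" where
    count: "\<And>b. b \<in> j ` P \<Longrightarrow> countable {A \<in> P. j A = b}"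
    and t_comm: "\<And>b v. b \<in> j ` P \<Longrightarrow> t (ind (block j b) v) = ind (block j b) (t v)"
    using countable_components t by blast
  \<comment> \<open>The numbering is injective within each component only; numbers recur in
    different components, where the errors are never added together.\<close>
  define n where "n A = to_nat_on {B \<in> P. j B = j A} A" for A
  define d where "d A = \<epsilon> * (1/2) ^ Suc (n A)" for A
  have d_pos: "d A > 0" for A using \<open>\<epsilon> > 0\<close> by (simp add: d_def)
  have d_sum: "(\<Sum>A\<in>F. d A * c) \<le> \<epsilon> * c"
    if F: "finite F" "F \<subseteq> {A \<in> P. j A = b}" and b: "b \<in> j ` P" and "c \<ge> 0" for F b c
  proof -
    have "inj_on (to_nat_on {A \<in> P. j A = b}) {A \<in> P. j A = b}"
      by (rule inj_on_to_nat_on[OF count[OF b]])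
    then have "inj_on (to_nat_on {A \<in> P. j A = b}) F"
      using F(2) by (rule inj_on_subset)
    moreover have "n A = to_nat_on {A \<in> P. j A = b} A" if "A \<in> F" for A
      using that F(2) by (auto simp: n_def)
    ultimately have "inj_on n F"
      by (simp cong: inj_on_cong)
    then have "\<epsilon> * (\<Sum>A\<in>F. (1/2) ^ Suc (n A)) \<le> \<epsilon> * 1"
      using sum_geometric_inj_le[OF F(1)] \<open>\<epsilon> > 0\<close> by (intro mult_left_mono) auto
    then have "(\<Sum>A\<in>F. d A) * c \<le> \<epsilon> * c"
      using \<open>c \<ge> 0\<close> unfolding d_def sum_distrib_left[symmetric] by (intro mult_right_mono) auto
    then show ?thesis by (simp add: sum_distrib_right)
  qed
  obtain S where S: "part_vectors S"
    and approx: "\<And>q A. is_projection q \<Longrightarrow> fixes_vectors q S \<Longrightarrow> A \<in> P \<Longrightarrow>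
       norm ((ind A o\<^sub>L t) - (q o\<^sub>L (ind A o\<^sub>L t))) \<le> d A \<and>
       norm ((t o\<^sub>L ind A) - ((t o\<^sub>L ind A) o\<^sub>L q)) \<le> d A"
    using approximating_vectors[of t d] t d_pos unfolding Cstar_lc_def by blast
  show ?thesis
  proof (rule that[OF S])
    fix q assume q: "q \<in> lf_projections" and fix_q: "fixes_vectors q S"
    have proj: "is_projection q" and bd: "block_diagonal q"
      using q by (simp_all add: lf_projections_def)
    have q_part: "q (ind A v) = ind A (q v)" if "A \<in> P" for A v
      using bd that by (simp add: block_diagonal_def)
    have q_block: "q (ind (block j b) v) = ind (block j b) (q v)" for b v
      unfolding block_def by (rule block_diagonal_Union[OF bd]) blast
    have bound: "norm (r v) \<le> c * norm v" if "norm r \<le> c" for r :: "'h \<Rightarrow>\<^sub>L 'h" and c v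
      using norm_blinfun[of r v] mult_right_mono[OF that norm_ge_zero[of v]] by linarith
    have "norm (t - (q o\<^sub>L t)) \<le> \<epsilon>"
    proof (rule norm_le_if_block_diagonal[of _ j])
      fix b v assume b: "b \<in> j ` P"
      let ?w = "ind (block j b) v"
      show u_comm: "(t - (q o\<^sub>L t)) (ind (block j b) v) = ind (block j b) ((t - (q o\<^sub>L t)) v)"
        by (simp add: blinfun.diff_left blinfun.diff_right t_comm[OF b] q_block)
      \<comment> \<open>For multiplication on the left the output of the error is decomposed into
        parts: as \<open>q\<close> commutes with \<open>ind A\<close>, its component at
        \<open>A\<close> is the error for \<open>ind A o\<^sub>L t\<close>.\<close>
      have series: "((\<lambda>A. ind A ((t - (q o\<^sub>L t)) v)) has_sum (t - (q o\<^sub>L t)) ?w) {A \<in> P. j A = b}"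
        unfolding u_comm by (rule has_sum_ind_within_block)
      have summand: "norm (ind A ((t - (q o\<^sub>L t)) v)) \<le> d A * norm ?w" if A: "A \<in> P" "j A = b" for A
      proof -
        have "ind A ((t - (q o\<^sub>L t)) v) = ind A ((t - (q o\<^sub>L t)) ?w)"
          unfolding u_comm unfolding block_def using A by (simp add: ind_part_Union)
        also have "\<dots> = ((ind A o\<^sub>L t) - (q o\<^sub>L (ind A o\<^sub>L t))) ?w"
          by (simp add: blinfun.diff_left blinfun.diff_right q_part[OF A(1)])
        finally show ?thesis
          using bound approx[OF proj fix_q A(1)] by simp
      qed
      show "norm ((t - (q o\<^sub>L t)) ?w) \<le> \<epsilon> * norm ?w"
      proof (rule norm_has_sum_le[OF series])
        fix F assume F: "finite F" "F \<subseteq> {A \<in> P. j A = b}"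
        have "norm (\<Sum>A\<in>F. ind A ((t - (q o\<^sub>L t)) v)) \<le> (\<Sum>A\<in>F. d A * norm ?w)"
          by (rule sum_norm_le) (use F summand in blast)
        also have "\<dots> \<le> \<epsilon> * norm ?w"
          by (rule d_sum[OF F b]) simp
        finally show "norm (\<Sum>A\<in>F. ind A ((t - (q o\<^sub>L t)) v)) \<le> \<epsilon> * norm ?w" .
      qed
    qed (use \<open>\<epsilon> > 0\<close> in simp)
    moreover have "norm (t - (t o\<^sub>L q)) \<le> \<epsilon>"
    proof (rule norm_le_if_block_diagonal[of _ j])
      fix b v assume b: "b \<in> j ` P"
      let ?w = "ind (block j b) v"
      show "(t - (t o\<^sub>L q)) (ind (block j b) v) = ind (block j b) ((t - (t o\<^sub>L q)) v)"
        by (simp add: blinfun.diff_left blinfun.diff_right t_comm[OF b] q_block)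
      \<comment> \<open>For multiplication on the right the input is decomposed instead, which leads
        to the errors for \<open>t o\<^sub>L ind A\<close>.\<close>
      have series: "((\<lambda>A. (t - (t o\<^sub>L q)) (ind A v)) has_sum (t - (t o\<^sub>L q)) ?w) {A \<in> P. j A = b}"
        by (rule has_sum_bounded_linear[OF blinfun.bounded_linear_right has_sum_ind_within_block])
      have summand: "norm ((t - (t o\<^sub>L q)) (ind A v)) \<le> d A * norm ?w" if A: "A \<in> P" "j A = b" for A
      proof -
        have "(t - (t o\<^sub>L q)) (ind A v) = (t - (t o\<^sub>L q)) (ind A ?w)"
          unfolding block_def using A by (simp add: ind_part_Union)
        also have "\<dots> = ((t o\<^sub>L ind A) - ((t o\<^sub>L ind A) o\<^sub>L q)) ?w"
          by (simp add: blinfun.diff_left q_part[OF A(1)])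
        finally show ?thesis
          using bound approx[OF proj fix_q A(1)] by simp
      qed
      show "norm ((t - (t o\<^sub>L q)) ?w) \<le> \<epsilon> * norm ?w"
      proof (rule norm_has_sum_le[OF series])
        fix F assume F: "finite F" "F \<subseteq> {A \<in> P. j A = b}"
        have "norm (\<Sum>A\<in>F. (t - (t o\<^sub>L q)) (ind A v)) \<le> (\<Sum>A\<in>F. d A * norm ?w)"
          by (rule sum_norm_le) (use F summand in blast)
        also have "\<dots> \<le> \<epsilon> * norm ?w"
          by (rule d_sum[OF F b]) simp
        finally show "norm (\<Sum>A\<in>F. (t - (t o\<^sub>L q)) (ind A v)) \<le> \<epsilon> * norm ?w" .
      qed
    qed (use \<open>\<epsilon> > 0\<close> in simp)
    ultimately show "norm (t - (q o\<^sub>L t)) \<le> \<epsilon> \<and> norm (t - (t o\<^sub>L q)) \<le> \<epsilon>" by blast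
  qed
qed

section \<open>The Roe algebra and the approximate unit\<close>

lemma closed_Cstar_lc: "closed (Cstar_lc X \<E> \<A> ind)"
proof -
  have left: "continuous_on UNIV (\<lambda>t. ind A o\<^sub>L t)" and right: "continuous_on UNIV (\<lambda>t. t o\<^sub>L ind A)" for A
    by (intro linear_continuous_on bounded_bilinear.bounded_linear_right
        bounded_bilinear.bounded_linear_left bounded_bilinear_blinfun_compose)+
  have "Cstar_lc X \<E> \<A> ind = cblinfuns \<inter> (\<Inter>A\<in>{A \<in> \<A>. coarsely_bounded X \<E> A}.
      (\<lambda>t. ind A o\<^sub>L t) -` {t. compact_op t} \<inter> (\<lambda>t. t o\<^sub>L ind A) -` {t. compact_op t})"
    by (auto simp: Cstar_lc_def locally_compact_op_def)
  then show ?thesis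
    by (simp only:) (intro closed_Int closed_cblinfuns closed_INT ballI closed_vimage closed_compact_op left right)
qed

lemma Cstar_Roe_subset: "Cstar_Roe X \<E> \<A> ind \<subseteq> Cstar_cp \<E> \<A> ind \<inter> Cstar_lc X \<E> \<A> ind"
  unfolding Cstar_Roe_def
proof (rule Int_greatest)
  have "Roe_alg X \<E> \<A> ind \<subseteq> Cstar_lc X \<E> \<A> ind"
    by (auto simp: Roe_alg_def Cstar_lc_def)
  then show "closure (Roe_alg X \<E> \<A> ind) \<subseteq> Cstar_lc X \<E> \<A> ind"
    by (rule closure_minimal[OF _ closed_Cstar_lc])
  show "closure (Roe_alg X \<E> \<A> ind) \<subseteq> Cstar_cp \<E> \<A> ind"
    unfolding Cstar_cp_def by (rule closure_mono) (auto simp: Roe_alg_def)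
qed

text \<open>Half of \<open>e\<close> is spent on replacing \<open>t\<close> by
  \<open>t o\<^sub>L p\<close>, the other half on replacing \<open>t\<close> by a controlled
  \<open>s\<close> in that product, where \<open>p\<close> is a contraction.\<close>

lemma subset_Cstar_Roe: "Cstar_cp \<E> \<A> ind \<inter> Cstar_lc X \<E> \<A> ind \<subseteq> Cstar_Roe X \<E> \<A> ind"
proof
  fix t assume t: "t \<in> Cstar_cp \<E> \<A> ind \<inter> Cstar_lc X \<E> \<A> ind"
  show "t \<in> Cstar_Roe X \<E> \<A> ind"
    unfolding Cstar_Roe_def closure_approachable
  proof (intro allI impI)
    fix e :: real assume "e > 0"
    then have "e/2 > 0" by simp
    obtain S where S: "part_vectors S"
      "\<And>q. q \<in> lf_projections \<Longrightarrow> fixes_vectors q S \<Longrightarrow> norm (t - (t o\<^sub>L q)) \<le> e/2"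
      using lf_projection_approximates[OF t \<open>e/2 > 0\<close>] by metis
    obtain p where p: "p \<in> lf_projections" "fixes_vectors p S"
      using lf_projection_fixing[OF S(1)] .
    obtain s where s: "s \<in> cblinfuns" "controlled_propagation \<E> \<A> ind s" "dist s t < e/2"
      using t \<open>e/2 > 0\<close> unfolding Cstar_cp_def by (auto simp only: Int_iff closure_approachable mem_Collect_eq)
    have "(s o\<^sub>L p) - t = ((s - t) o\<^sub>L p) + ((t o\<^sub>L p) - t)"
      by (rule blinfun_eqI) (simp add: blinfun.diff_left blinfun.add_left)
    then have "dist (s o\<^sub>L p) t \<le> norm ((s - t) o\<^sub>L p) + norm ((t o\<^sub>L p) - t)"
      by (metis dist_norm norm_triangle_ineq)
    moreover have "norm ((s - t) o\<^sub>L p) \<le> norm (s - t) * norm p"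
      by (rule norm_blinfun_compose)
    moreover have "norm (s - t) * norm p \<le> norm (s - t)"
      using p(1) is_projection_norm[of p] by (intro mult_left_le) (simp_all add: lf_projections_def)
    moreover have "norm ((t o\<^sub>L p) - t) \<le> e/2"
      using S(2)[OF p] by (simp add: norm_minus_commute)
    ultimately have "dist (s o\<^sub>L p) t < e"
      using s(3) unfolding dist_norm by linarith
    then show "\<exists>y\<in>Roe_alg X \<E> \<A> ind. dist y t < e"
      using compose_lf_projection_in_Roe_alg[OF s(1,2) p(1)] by blast
  qed
qed

lemma lf_projections_approximate_unit:
  "approximate_unit (Cstar_cp \<E> \<A> ind \<inter> Cstar_lc X \<E> \<A> ind) lf_projections
    (\<lambda>p q. q o\<^sub>L p = p) (\<lambda>p. p)"
  unfolding approximate_unit_def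
proof (intro conjI ballI impI lf_projections_directed)
  fix p assume p: "p \<in> lf_projections"
  then have proj: "is_projection p" by (simp add: lf_projections_def)
  have "p \<in> Cstar_Roe X \<E> \<A> ind"
    using lf_projections_in_Roe_alg[OF p] closure_subset unfolding Cstar_Roe_def by (rule rev_subsetD)
  then show "p \<in> Cstar_cp \<E> \<A> ind \<inter> Cstar_lc X \<E> \<A> ind"
    by (rule subsetD[OF Cstar_Roe_subset])
  show "positive_op p" by (rule is_projection_positive[OF proj])
  show "norm p \<le> 1" by (rule is_projection_norm[OF proj])
next
  fix p q assume "p \<in> lf_projections" "q \<in> lf_projections" "q o\<^sub>L p = p"
  then show "positive_op (q - p)"
    by (intro is_projection_positive is_projection_diff) (simp_all add: lf_projections_def)
next
  fix t assume t: "t \<in> Cstar_cp \<E> \<A> ind \<inter> Cstar_lc X \<E> \<A> ind"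
  have "\<exists>k\<in>lf_projections. \<forall>l\<in>lf_projections. l o\<^sub>L k = k \<longrightarrow>
      dist (l o\<^sub>L t) t < e \<and> dist (t o\<^sub>L l) t < e" if "e > 0" for e
  proof -
    have "e/2 > 0" using that by simp
    obtain S where S: "part_vectors S"
      "\<And>q. q \<in> lf_projections \<Longrightarrow> fixes_vectors q S \<Longrightarrow>
        norm (t - (q o\<^sub>L t)) \<le> e/2 \<and> norm (t - (t o\<^sub>L q)) \<le> e/2"
      using lf_projection_approximates[OF t \<open>e/2 > 0\<close>] by metis
    obtain k where k: "k \<in> lf_projections" "fixes_vectors k S"
      using lf_projection_fixing[OF S(1)] .
    have "dist (l o\<^sub>L t) t < e \<and> dist (t o\<^sub>L l) t < e" if l: "l \<in> lf_projections" "l o\<^sub>L k = k" for l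
    proof -
      \<comment> \<open>From \<open>l o\<^sub>L k = k\<close> and \<open>k x = x\<close> follows
        \<open>l x = x\<close>, so the estimate for projections fixing \<open>S\<close> holds on the
        whole tail above \<open>k\<close>, for both sides at once.\<close>
      have "fixes_vectors l S"
        using k(2) l(2) unfolding fixes_vectors_def by (metis blinfun_apply_blinfun_compose)
      then show ?thesis
        using S(2)[OF l(1)] \<open>e > 0\<close> unfolding dist_norm by (auto simp: norm_minus_commute[of _ t])
    qed
    then show ?thesis using k(1) by blast
  qed
  then show "net_tendsto lf_projections (\<lambda>p q. q o\<^sub>L p = p) (\<lambda>l. l o\<^sub>L t) t"
    "net_tendsto lf_projections (\<lambda>p q. q o\<^sub>L p = p) (\<lambda>l. t o\<^sub>L l) t"
    unfolding net_tendsto_def by meson+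
qed

end

theorem theorem6p20:
  fixes X :: "'x set" and \<E> :: "('x \<times> 'x) set set" and \<A> :: "'x set set"
    and ind :: "'x set \<Rightarrow> 'h::chilbert_space \<Rightarrow>\<^sub>L 'h"
  assumes "coarse_space X \<E>"
    and "coarsely_locally_finite X \<E>"
    and "discrete_module X \<E> \<A> ind"
  shows "(\<exists>(\<Lambda> :: ('h \<Rightarrow>\<^sub>L 'h) set) le p.
            approximate_unit (Cstar_cp \<E> \<A> ind \<inter> Cstar_lc X \<E> \<A> ind) \<Lambda> le p \<and>
            (\<forall>l\<in>\<Lambda>. is_projection (p l)) \<and>
            (\<exists>E. discreteness_gauge X \<E> \<A> ind E \<and> (\<forall>l\<in>\<Lambda>. supp_within \<A> ind (p l) E)) \<and>
            (\<forall>l\<in>\<Lambda>. locally_finite_rank X \<E> \<A> ind (p l)) \<and>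
            (\<forall>l\<in>\<Lambda>. p l \<in> Roe_alg X \<E> \<A> ind)) \<and>
         Cstar_cp \<E> \<A> ind \<inter> Cstar_lc X \<E> \<A> ind = Cstar_Roe X \<E> \<A> ind"
proof -
  interpret coarse_module X \<E> \<A> ind
    using assms(3) by (simp add: discrete_module_def)
  obtain G0 P0 where "gauge_of X \<E> G0" "discrete_partition X \<A> ind G0 P0"
    using assms(3) by (auto simp: discrete_module_def discreteness_gauge_def)
  then interpret fine: partitioned_module X \<E> \<A> ind G0 P0
    by unfold_locales
  obtain G P where GP: "gauge_of X \<E> G" "discrete_partition X \<A> ind G P"
    "locally_finite_family X \<E> P"
    using fine.locally_finite_coarsening[OF assms(2)] .
  then interpret locally_finite_module X \<E> \<A> ind G P
    by unfold_locales
  \<comment> \<open>The gauge controlling all the projections belongs to the coarsened partition,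
    with respect to which they are block diagonal.\<close>
  have "discreteness_gauge X \<E> \<A> ind G"
    using GP by (auto simp: discreteness_gauge_def)
  moreover have "is_projection p" "supp_within \<A> ind p G" if "p \<in> lf_projections" for p
    using that block_diagonal_supp by (auto simp: lf_projections_def)
  ultimately have "\<exists>E. discreteness_gauge X \<E> \<A> ind E \<and> (\<forall>l\<in>lf_projections. supp_within \<A> ind l E)"
    and "\<forall>l\<in>lf_projections. is_projection l"
    by blast+
  moreover have "\<forall>l\<in>lf_projections. locally_finite_rank X \<E> \<A> ind l"
    "\<forall>l\<in>lf_projections. l \<in> Roe_alg X \<E> \<A> ind"
    using lf_projections_locally_finite_rank lf_projections_in_Roe_alg by blast+
  moreover note lf_projections_approximate_unit
  ultimately show ?thesis
    using Cstar_Roe_subset subset_Cstar_Roe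
    by (intro conjI exI[of _ lf_projections] exI[of _ "\<lambda>p q. q o\<^sub>L p = p"] exI[of _ "\<lambda>p. p"]) auto
qed

end
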